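(* Let $\partial$ be a subdifferential and let $\mathcal{X}$ be a class of real Banach spaces which contains Cartesian products of its elements. If rule (R1) (fuzzy minimization rule) holds for $\partial$ on every space in $\mathcal{X}$, then for every $X\in\mathcal{X}$ the following two rules hold. (R2) Let $\{f_1,\ldots,f_k\}$ be a finite family of lower semicontinuous functions $X\to\mathbb{R}\cup\{+\infty\}$ that is decouplable at $\bar x\in X$. If $|\nabla(\sum_i f_i)|(\bar x)<\infty$, then there are sequences $((x_{i,n},x^*_{i,n}))_n\subset\partial f_i$, $i=1,\ldots,k$, such that for each $i$: $x_{i,n}\to\bar x$, $f_i(x_{i,n})\to f_i(\bar x)$ and $\operatorname{diam}(x_{1,n},\ldots,x_{k,n})\,\|x^*_{i,n}\|\to0$ as $n\to\infty$, and $$\limsup_n\Big\|\sum_{i=1}^k x^*_{i,n}\Big\|\le\Big|\nabla\Big(\sum_{i=1}^k f_i\Big)\Big|(\bar x).$$ (R3) Let $\{f_1,\ldots,f_k\}$ be a finite family of lower semicontinuous functions $X\to\mathbb{R}\cup\{+\infty\}$ that is $X^*$-decouplable at $\bar x\in X$. For any $\bar x^*\in\partial_F(\sum_i f_i)(\bar x)$ there are sequences $((x_{i,n},x^*_{i,n}))_n\subset\partial f_i$, $i=1,\ldots,k$, such that for each $i$: $x_{i,n}\to\bar x$, $f_i(x_{i,n})\to f_i(\bar x)$ and $\operatorname{diam}(x_{1,n},\ldots,x_{k,n})\,\|x^*_{i,n}\|\to0$, and $\sum_{i=1}^k x^*_{i,n}\to\bar x^*$.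
   Context: $\operatorname{LSC}(X)$ is the set of lower semicontinuous functions $X\to\mathbb{R}\cup\{+\infty\}$; $\operatorname{dom} f=\{x: f(x)<\infty\}$. $B_\lambda(x)$ is the closed ball of radius $\lambda$ centered at $x$ (with $B_0(x)=\{x\}$); $\inf\emptyset=+\infty$. $\operatorname{diam}(x_1,\ldots,x_k)=\max_{i,j}\|x_i-x_j\|$. Convergence in $X^*$ is in norm. Finite products of Banach spaces carry the max norm, $X^k$ is regarded as the iterated product $X\times X^{k-1}$, and the dual of a product is identified with the product of the duals. Slope: for $x\in\operatorname{dom} f$, $|\nabla f|(x):=\limsup_{y\to x,\,y\ne x}\frac{(f(x)-f(y))^+}{\|x-y\|}$, where $\alpha^+=\max(0,\alpha)$; the condition $|\nabla f|(x)<\infty$ includes $x\in\operatorname{dom} f$. Fréchet subdifferential: for $\bar x\in\operatorname{dom} f$, $\partial_F f(\bar x):=\{\bar x^*\in X^*:\liminf_{x\to\bar x,\,x\ne\bar x}\frac{f(x)-f(\bar x)-\langle\bar x^*,x-\bar x\rangle}{\|x-\bar x\|}\ge0\}$ (and $\bar x^*\in\partial_F f(\bar x)$ presupposes $\bar x\in\operatorname{dom} f$). Subdifferential: an operator $\partial$ associating a set $\partial f(x)\subset X^*$ to any triplet $(X,f,x)$, where $X$ is a Banach space, $f\in\operatorname{LSC}(X)$ and $x\in X$, such that: (A1) if $f(x)<\infty$ and $f$ is convex on a convex neighborhood $U$ of $x$, then $\partial f(x)=\{x^*\in X^*:\langle x^*,y-x\rangle+f(x)\le f(y)\ \ \forall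 y\in U\}$; (A2) if $F(x,y)=f(x)+g(y)$ on a product of Banach spaces, then $\partial F(x,y)\subset\partial f(x)\times\partial g(y)$; (A3) for any $f$ and $x^*\in X^*$, $\partial(f+x^* )(x)=\partial f(x)+x^*$. We also write $\partial f=\{(x,x^* )\in X\times X^*: x^*\in\partial f(x)\}$ for the graph. Rule (R1) on $X$: for any $f\in\operatorname{LSC}(X)$ and any convex Lipschitz $\varphi:X\to\mathbb{R}$, if $f+\varphi$ admits a finite local minimum at $z$, then there are sequences $((x_n,x_n^* ))_n\subset\partial f$ and $((y_n,y_n^* ))_n\subset\partial\varphi$ such that $x_n\to z$, $y_n\to z$, $f(x_n)\to f(z)$ and $x_n^*+y_n^*\to0$. Decouplability: $\{f_1,\ldots,f_k\}\subset\operatorname{LSC}(X)$ is decouplable at $\bar x\in X$ if there is $\lambda_{\bar x}>0$ such that for every $\lambda\in[0,\lambda_{\bar x})$, $$\sup_{\delta>0}\ \inf_{B_{\lambda+\delta}(\bar x)}\sum_i f_i\ \le\ \sup_{\delta>0}\ \inf\Big\{\sum_i f_i(x_i): x_i\in B_\lambda(\bar x)\ \forall i,\ \|x_i-x_j\|\le\delta\ \forall i,j\Big\}.$$ It is $X^*$-decouplable at $\bar x$ if $\{f_1,\ldots,f_k,x^*\}$ is decouplable at $\bar x$ for every $x^*\in X^*$. *)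

theory Defs
  imports "HOL-Analysis.Analysis" "HOL-Algebra.Algebraic_Closure_Type"
begin

text \<open>
  A subdifferential is one operator acting on all Banach spaces simultaneously, and a class of
  Banach spaces is to be closed under products, so Banach spaces cannot be types here: they are
  carrier-based structures. The ambient type is closed under (free) pairing, so that the product
  of two spaces lives over the same type. The parameter type \<open>'a\<close> is arbitrary.
  Spaces are called \<open>E\<close> and \<open>G\<close> because the letter X is notation in HOL-Algebra.
\<close>

datatype 'a uni = Pt 'a | Pr (lft: "'a uni") (rgt: "'a uni")


section \<open>Banach spaces\<close>

text \<open>
  The fields \<open>mult\<close> and \<open>one\<close>, which \<open>module\<close> inherits from \<open>ring\<close>, play no role.
  The term \<open>ring_of_type_algebra\<close>, at type \<open>real ring\<close>, is the field of real numbers.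
\<close>

record 'v nvs = "(real, 'v) module" +
  nrm :: "'v \<Rightarrow> real"

text \<open>The locale \<open>Metric_space\<close> demands nonnegativity and symmetry on the whole type,
  hence the value 0 off the carrier.\<close>

definition ndist :: "'v nvs \<Rightarrow> 'v \<Rightarrow> 'v \<Rightarrow> real" where
  "ndist E x y = (if x \<in> carrier E \<and> y \<in> carrier E then nrm E (x \<ominus>\<^bsub>E\<^esub> y) else 0)"

abbreviation ntop :: "'v nvs \<Rightarrow> 'v topology" where
  "ntop E \<equiv> Metric_space.mtopology (carrier E) (ndist E)"

abbreviation nball :: "'v nvs \<Rightarrow> 'v \<Rightarrow> real \<Rightarrow> 'v set" where
  "nball E \<equiv> Metric_space.mball (carrier E) (ndist E)"

abbreviation ncball :: "'v nvs \<Rightarrow> 'v \<Rightarrow> real \<Rightarrow> 'v set" where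
  "ncball E \<equiv> Metric_space.mcball (carrier E) (ndist E)"

locale banach_space = Module.module "ring_of_type_algebra :: real ring" E
  for E :: "'v nvs" (structure) +
  assumes nrm_eq_0: "x \<in> carrier E \<Longrightarrow> nrm E x = 0 \<longleftrightarrow> x = \<zero>"
    and nrm_smult: "x \<in> carrier E \<Longrightarrow> nrm E (c \<odot>\<^bsub>E\<^esub> x) = \<bar>c\<bar> * nrm E x"
    and nrm_triangle:
      "x \<in> carrier E \<Longrightarrow> y \<in> carrier E \<Longrightarrow> nrm E (x \<oplus>\<^bsub>E\<^esub> y) \<le> nrm E x + nrm E y"
    and complete: "Metric_space.mcomplete (carrier E) (ndist E)"

definition prod_space :: "'a uni nvs \<Rightarrow> 'a uni nvs \<Rightarrow> 'a uni nvs" where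
  "prod_space E G =
    \<lparr> carrier = {Pr x y | x y. x \<in> carrier E \<and> y \<in> carrier G},
      monoid.mult = undefined,
      one = undefined,
      zero = Pr \<zero>\<^bsub>E\<^esub> \<zero>\<^bsub>G\<^esub>,
      add = (\<lambda>u v. Pr (lft u \<oplus>\<^bsub>E\<^esub> lft v) (rgt u \<oplus>\<^bsub>G\<^esub> rgt v)),
      smult = (\<lambda>c u. Pr (c \<odot>\<^bsub>E\<^esub> lft u) (c \<odot>\<^bsub>G\<^esub> rgt u)),
      nrm = (\<lambda>u. max (nrm E (lft u)) (nrm G (rgt u))) \<rparr>"


section \<open>Functions and functionals on a Banach space\<close>

text \<open>
  Functions \<open>E \<rightarrow> \<real> \<union> {+\<infinity>}\<close> are extended by \<open>+\<infinity>\<close>, and continuous linear functionals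
  by 0, off the carrier. This makes the representing HOL function unique, and sums can be
  formed pointwise.
\<close>

definition LSC :: "'v nvs \<Rightarrow> ('v \<Rightarrow> ereal) set" where
  "LSC E = {f. (\<forall>x. f x \<noteq> -\<infinity>) \<and> (\<forall>x. x \<notin> carrier E \<longrightarrow> f x = \<infinity>) \<and>
               (\<forall>x\<in>carrier E. f x \<le> Liminf (atin (ntop E) x) f)}"

definition ext :: "'v nvs \<Rightarrow> ('v \<Rightarrow> real) \<Rightarrow> 'v \<Rightarrow> ereal" where
  "ext E \<phi> = (\<lambda>x. if x \<in> carrier E then ereal (\<phi> x) else \<infinity>)"

definition dual :: "'v nvs \<Rightarrow> ('v \<Rightarrow> real) set" where
  "dual E = {l. (\<forall>x. x \<notin> carrier E \<longrightarrow> l x = 0) \<and>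
                (\<forall>x\<in>carrier E. \<forall>y\<in>carrier E. l (x \<oplus>\<^bsub>E\<^esub> y) = l x + l y) \<and>
                (\<forall>c. \<forall>x\<in>carrier E. l (c \<odot>\<^bsub>E\<^esub> x) = c * l x) \<and>
                (\<exists>C. \<forall>x\<in>carrier E. \<bar>l x\<bar> \<le> C * nrm E x)}"

definition dual_norm :: "'v nvs \<Rightarrow> ('v \<Rightarrow> real) \<Rightarrow> real" where
  "dual_norm E l = (SUP x\<in>{x \<in> carrier E. nrm E x \<le> 1}. \<bar>l x\<bar>)"

definition sep_sum :: "('a uni \<Rightarrow> ereal) \<Rightarrow> ('a uni \<Rightarrow> ereal) \<Rightarrow> 'a uni \<Rightarrow> ereal" where
  "sep_sum f g u = (case u of Pt _ \<Rightarrow> \<infinity> | Pr x y \<Rightarrow> f x + g y)"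

text \<open>The element of the dual of a product corresponding to a pair of functionals.\<close>

definition dual_pair ::
  "'a uni nvs \<Rightarrow> 'a uni nvs \<Rightarrow> ('a uni \<Rightarrow> real) \<Rightarrow> ('a uni \<Rightarrow> real) \<Rightarrow> 'a uni \<Rightarrow> real" where
  "dual_pair E G l m u = (if u \<in> carrier (prod_space E G) then l (lft u) + m (rgt u) else 0)"

definition nconvex :: "'v nvs \<Rightarrow> 'v set \<Rightarrow> bool" where
  "nconvex E U \<longleftrightarrow> U \<subseteq> carrier E \<and>
    (\<forall>u\<in>U. \<forall>v\<in>U. \<forall>t\<in>{0..1}. (1 - t) \<odot>\<^bsub>E\<^esub> u \<oplus>\<^bsub>E\<^esub> t \<odot>\<^bsub>E\<^esub> v \<in> U)"

definition nconvex_on :: "'v nvs \<Rightarrow> 'v set \<Rightarrow> ('v \<Rightarrow> ereal) \<Rightarrow> bool" where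
  "nconvex_on E U f \<longleftrightarrow>
    (\<forall>u\<in>U. \<forall>v\<in>U. \<forall>t\<in>{0..1}.
      f ((1 - t) \<odot>\<^bsub>E\<^esub> u \<oplus>\<^bsub>E\<^esub> t \<odot>\<^bsub>E\<^esub> v) \<le> ereal (1 - t) * f u + ereal t * f v)"

definition nlipschitz :: "'v nvs \<Rightarrow> ('v \<Rightarrow> real) \<Rightarrow> bool" where
  "nlipschitz E \<phi> \<longleftrightarrow>
    (\<exists>L. \<forall>x\<in>carrier E. \<forall>y\<in>carrier E. \<bar>\<phi> x - \<phi> y\<bar> \<le> L * ndist E x y)"

text \<open>The slope is \<open>+\<infinity>\<close> off the domain. The outer \<open>max 0\<close> matters only in the zero space, where
  the upper limit is over the trivial filter; it is then taken in \<open>[0,\<infinity>]\<close>, i.e. equal to 0.\<close>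

definition slope :: "'v nvs \<Rightarrow> ('v \<Rightarrow> ereal) \<Rightarrow> 'v \<Rightarrow> ereal" where
  "slope E f x =
    (if x \<in> carrier E \<and> f x < \<infinity>
     then max 0 (Limsup (atin (ntop E) x) (\<lambda>y. max 0 (f x - f y) / ereal (ndist E x y)))
     else \<infinity>)"

definition frechet_subdiff :: "'v nvs \<Rightarrow> ('v \<Rightarrow> ereal) \<Rightarrow> 'v \<Rightarrow> ('v \<Rightarrow> real) set" where
  "frechet_subdiff E f x =
    {l \<in> dual E. x \<in> carrier E \<and> f x < \<infinity> \<and>
       0 \<le> Liminf (atin (ntop E) x)
             (\<lambda>y. (f y - f x - ereal (l (y \<ominus>\<^bsub>E\<^esub> x))) / ereal (ndist E y x))}"


section \<open>Subdifferentials and the fuzzy minimization rule\<close>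

type_synonym 'v subdiff_op = "'v nvs \<Rightarrow> ('v \<Rightarrow> ereal) \<Rightarrow> 'v \<Rightarrow> ('v \<Rightarrow> real) set"

definition subdifferential :: "'a uni subdiff_op \<Rightarrow> bool" where
  "subdifferential D \<longleftrightarrow>
    (\<forall>E f x. banach_space E \<and> f \<in> LSC E \<and> x \<in> carrier E \<longrightarrow> D E f x \<subseteq> dual E) \<and>
    (\<forall>E f x U. banach_space E \<and> f \<in> LSC E \<and> x \<in> carrier E \<and> f x < \<infinity> \<and>
        nconvex E U \<and> x \<in> ntop E interior_of U \<and> nconvex_on E U f \<longrightarrow>
        D E f x = {l \<in> dual E. \<forall>y\<in>U. ereal (l (y \<ominus>\<^bsub>E\<^esub> x)) + f x \<le> f y}) \<and>
    (\<forall>E G f g x y. banach_space E \<and> banach_space G \<and> f \<in> LSC E \<and> g \<in> LSC G \<and>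
        x \<in> carrier E \<and> y \<in> carrier G \<longrightarrow>
        D (prod_space E G) (sep_sum f g) (Pr x y)
          \<subseteq> {dual_pair E G l m | l m. l \<in> D E f x \<and> m \<in> D G g y}) \<and>
    (\<forall>E f l x. banach_space E \<and> f \<in> LSC E \<and> l \<in> dual E \<and> x \<in> carrier E \<longrightarrow>
        D E (\<lambda>y. f y + ereal (l y)) x = (\<lambda>m y. m y + l y) ` D E f x)"

definition subdiff_graph ::
  "'v subdiff_op \<Rightarrow> 'v nvs \<Rightarrow> ('v \<Rightarrow> ereal) \<Rightarrow> ('v \<times> ('v \<Rightarrow> real)) set" where
  "subdiff_graph D E f = {(x, l). x \<in> carrier E \<and> l \<in> D E f x}"

definition fuzzy_min_rule :: "'v subdiff_op \<Rightarrow> 'v nvs \<Rightarrow> bool" where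
  "fuzzy_min_rule D E \<longleftrightarrow>
    (\<forall>f \<phi> z. f \<in> LSC E \<and> nconvex_on E (carrier E) (ext E \<phi>) \<and> nlipschitz E \<phi> \<and>
        z \<in> carrier E \<and> f z < \<infinity> \<and>
        (\<exists>r>0. \<forall>y\<in>nball E z r. f z + ext E \<phi> z \<le> f y + ext E \<phi> y) \<longrightarrow>
        (\<exists>x xs y ys.
          (\<forall>n. (x n, xs n) \<in> subdiff_graph D E f) \<and>
          (\<forall>n. (y n, ys n) \<in> subdiff_graph D E (ext E \<phi>)) \<and>
          limitin (ntop E) x z sequentially \<and>
          limitin (ntop E) y z sequentially \<and>
          (\<lambda>n. f (x n)) \<longlonglongrightarrow> f z \<and>
          (\<lambda>n. dual_norm E (\<lambda>v. xs n v + ys n v)) \<longlonglongrightarrow> 0))"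


section \<open>Decouplable families\<close>

text \<open>A family \<open>f\<^sub>1, \<dots>, f\<^sub>k\<close> is given by \<open>k\<close> and a function on \<open>nat\<close>, of which only the
  values on \<open>{1..k}\<close> matter.\<close>

definition decouplable :: "'v nvs \<Rightarrow> nat \<Rightarrow> (nat \<Rightarrow> 'v \<Rightarrow> ereal) \<Rightarrow> 'v \<Rightarrow> bool" where
  "decouplable E k f x \<longleftrightarrow>
    (\<exists>\<Lambda>>0. \<forall>lam\<in>{0..<\<Lambda>}.
      (SUP \<delta>\<in>{0<..}. INF y\<in>ncball E x (lam + \<delta>). \<Sum>i=1..k. f i y)
      \<le> (SUP \<delta>\<in>{0<..}. Inf {\<Sum>i=1..k. f i (y i) | y.
            (\<forall>i\<in>{1..k}. y i \<in> ncball E x lam) \<and>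
            (\<forall>i\<in>{1..k}. \<forall>j\<in>{1..k}. ndist E (y i) (y j) \<le> \<delta>)}))"

definition dual_decouplable :: "'v nvs \<Rightarrow> nat \<Rightarrow> (nat \<Rightarrow> 'v \<Rightarrow> ereal) \<Rightarrow> 'v \<Rightarrow> bool" where
  "dual_decouplable E k f x \<longleftrightarrow>
    (\<forall>l\<in>dual E. decouplable E (Suc k) (f(Suc k := ext E l)) x)"

definition ndiam :: "'v nvs \<Rightarrow> nat \<Rightarrow> (nat \<Rightarrow> 'v) \<Rightarrow> real" where
  "ndiam E k x = Max {ndist E (x i) (x j) | i j. i \<in> {1..k} \<and> j \<in> {1..k}}"

end

theory Submission
  imports Defs
begin

text \<open>
  Put \<open>S = f\<^sub>1 + \<dots> + f\<^sub>k\<close> and let \<open>\<tau>\<close> exceed the slope of \<open>S\<close> at \<open>x\<close>, so that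
  \<open>S + \<tau> * \<parallel>_ - x\<parallel>\<close> has a local minimum at \<open>x\<close>. The idea is to let the arguments of the
  \<open>f\<^sub>i\<close> vary independently and to penalize their distance. On \<open>E\<^sup>k\<close> with the maximum norm let
  \<open>F u = f\<^sub>1 u\<^sub>1 + \<dots> + f\<^sub>k u\<^sub>k\<close>, let \<open>c = (x, \<dots>, x)\<close>, and consider
  \<open>G u = F u + \<tau> * \<parallel>u - c\<parallel> + N * diam u\<close>.

  Decouplability says that on small balls the infimum of \<open>F\<close> over almost diagonal tuples is not
  essentially below that of \<open>S\<close> (\<open>decouplable_lower_bound\<close>). Away from the diagonal the term
  \<open>N * diam u\<close> with a large \<open>N\<close> dominates, because \<open>F\<close> is bounded below near \<open>c\<close> by lower
  semicontinuity. Therefore \<open>c\<close> almost minimizes \<open>G\<close> on a ball around it. Ekeland's principle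
  (\<open>ekeland\<close>) gives a point \<open>z\<close> close to \<open>c\<close> that minimizes \<open>G + \<kappa> * \<parallel>_ - z\<parallel>\<close> on the
  ball. It is an interior point, so the fuzzy minimization rule on \<open>E\<^sup>k\<close> applies to \<open>F\<close> and the
  convex Lipschitz function \<open>\<tau> * \<parallel>_ - c\<parallel> + N * diam + \<kappa> * \<parallel>_ - z\<parallel>\<close>. Subgradients of \<open>F\<close>
  split into subgradients \<open>m\<^sub>i\<close> of the \<open>f\<^sub>i\<close> by the axiom on separable sums.

  The required estimates come from the form of the penalty. The diameter does not change under
  diagonal translations, so testing a subgradient of the penalty with \<open>(h, \<dots>, h)\<close> yields
  \<open>\<parallel>m\<^sub>1 + \<dots> + m\<^sub>k\<parallel> \<le> \<tau> + \<kappa> + small\<close>, regardless of \<open>N\<close>. The Lipschitz constant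
  \<open>\<tau> + 2 * N + \<kappa>\<close> of the penalty bounds each \<open>\<parallel>m\<^sub>i\<parallel>\<close> (\<open>components_bound\<close>), and the product
  with the diameter is small because \<open>N * diam z \<le> S x - F z\<close>, which lower semicontinuity makes
  small. This is \<open>approximate_sum_rule\<close>, and letting the tolerances tend to 0 gives
  \<open>slope_sum_rule\<close>.

  If \<open>l\<close> is a Frechet subgradient of \<open>S\<close> at \<open>x\<close>, then \<open>S - l\<close> has slope 0 there. The rule for
  slopes, applied to the \<open>k + 1\<close> functions \<open>f\<^sub>1, \<dots>, f\<^sub>k, - l\<close>, whose last one has \<open>- l\<close> as its only
  subgradient, gives \<open>frechet_sum_rule\<close>.
\<close>

section \<open>Normed structure\<close>

context banach_space
begin

lemma scalar_closed [simp, intro]: "x \<in> carrier E \<Longrightarrow> (c::real) \<odot>\<^bsub>E\<^esub> x \<in> carrier E"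
  by (rule smult_closed) (auto simp: ring_of_type_algebra_def)

lemma scalar_add: "x \<in> carrier E \<Longrightarrow> (c + d :: real) \<odot>\<^bsub>E\<^esub> x = c \<odot>\<^bsub>E\<^esub> x \<oplus> d \<odot>\<^bsub>E\<^esub> x"
  using smult_l_distr[of c d x] by (simp add: ring_of_type_algebra_def)

lemma scalar_distrib:
  "x \<in> carrier E \<Longrightarrow> y \<in> carrier E \<Longrightarrow> (c::real) \<odot>\<^bsub>E\<^esub> (x \<oplus> y) = c \<odot>\<^bsub>E\<^esub> x \<oplus> c \<odot>\<^bsub>E\<^esub> y"
  using smult_r_distr[of c x y] by (simp add: ring_of_type_algebra_def)

lemma scalar_assoc: "x \<in> carrier E \<Longrightarrow> (c * d :: real) \<odot>\<^bsub>E\<^esub> x = c \<odot>\<^bsub>E\<^esub> (d \<odot>\<^bsub>E\<^esub> x)"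
  using smult_assoc1[of c d x] by (simp add: ring_of_type_algebra_def)

lemma scalar_one [simp]: "x \<in> carrier E \<Longrightarrow> (1::real) \<odot>\<^bsub>E\<^esub> x = x"
  using smult_one[of x] by (simp add: ring_of_type_algebra_def)

lemma scalar_zero [simp]: "x \<in> carrier E \<Longrightarrow> (0::real) \<odot>\<^bsub>E\<^esub> x = \<zero>"
  using smult_l_null[of x] by (simp add: ring_of_type_algebra_def)

lemma neg_eq_scalar: "x \<in> carrier E \<Longrightarrow> \<ominus> x = (-1::real) \<odot>\<^bsub>E\<^esub> x"
  using scalar_add[of x 1 "-1"] by (simp add: minus_equality M.add.m_comm)

lemma diff_eq_scalar: "x \<in> carrier E \<Longrightarrow> y \<in> carrier E \<Longrightarrow> x \<ominus> y = x \<oplus> (-1::real) \<odot>\<^bsub>E\<^esub> y"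
  by (simp add: M.minus_eq neg_eq_scalar)

lemma nrm_zero [simp]: "nrm E \<zero> = 0"
  using nrm_eq_0[of \<zero>] by simp

lemma nrm_neg: "x \<in> carrier E \<Longrightarrow> nrm E (\<ominus> x) = nrm E x"
  by (simp add: neg_eq_scalar nrm_smult)

lemma nrm_nonneg [simp]: "x \<in> carrier E \<Longrightarrow> 0 \<le> nrm E x"
  using nrm_triangle[of x "\<ominus> x"] by (simp add: nrm_neg M.r_neg)

lemma ndist_eq: "x \<in> carrier E \<Longrightarrow> y \<in> carrier E \<Longrightarrow> ndist E x y = nrm E (x \<ominus> y)"
  by (simp add: ndist_def)

lemma Metric_space_ndist: "Metric_space (carrier E) (ndist E)"
proof
  show "0 \<le> ndist E x y" for x y by (simp add: ndist_def)
  show "ndist E x y = ndist E y x" for x y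
  proof (cases "x \<in> carrier E \<and> y \<in> carrier E")
    case True
    then have "y \<ominus> x = \<ominus> (x \<ominus> y)" by (simp add: M.minus_eq M.minus_add M.a_comm)
    with True show ?thesis using nrm_neg[of "x \<ominus> y"] by (simp add: ndist_def)
  qed (auto simp: ndist_def)
  show "(ndist E x y = 0) = (x = y)" if "x \<in> carrier E" "y \<in> carrier E" for x y
  proof -
    have "x = (x \<ominus> y) \<oplus> y" using that by (simp add: M.minus_eq M.a_assoc M.l_neg)
    then have "x \<ominus> y = \<zero> \<Longrightarrow> x = y" using that by simp
    then show ?thesis using that by (auto simp: ndist_def nrm_eq_0 M.minus_eq M.r_neg)
  qed
  show "ndist E x z \<le> ndist E x y + ndist E y z"
    if "x \<in> carrier E" "y \<in> carrier E" "z \<in> carrier E" for x y z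
  proof -
    have "x \<ominus> z = (x \<ominus> y) \<oplus> (y \<ominus> z)"
      using that by (simp add: M.minus_eq M.a_assoc M.r_neg1)
    then show ?thesis using that nrm_triangle[of "x \<ominus> y" "y \<ominus> z"] by (simp add: ndist_def)
  qed
qed

sublocale metric: Metric_space "carrier E" "ndist E"
  by (rule Metric_space_ndist)

lemma limitin_if_ndist_le:
  assumes "\<And>n. y n \<in> carrier E" "x \<in> carrier E" "\<And>n. ndist E (y n) x \<le> b n" "b \<longlonglongrightarrow> 0"
  shows "limitin metric.mtopology y x sequentially"
  unfolding metric.limitin_metric_dist_null
  using assms tendsto_sandwich[OF _ _ tendsto_const assms(4), of "\<lambda>n. ndist E (y n) x"] by simp

lemma diff_comb:
  assumes "a \<in> carrier E" "b \<in> carrier E" "c \<in> carrier E" "d \<in> carrier E"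
  shows "(s \<odot>\<^bsub>E\<^esub> a \<oplus> t \<odot>\<^bsub>E\<^esub> b) \<ominus> (s \<odot>\<^bsub>E\<^esub> c \<oplus> t \<odot>\<^bsub>E\<^esub> d)
         = s \<odot>\<^bsub>E\<^esub> (a \<ominus> c) \<oplus> t \<odot>\<^bsub>E\<^esub> (b \<ominus> d)"
proof -
  have *: "(-1) \<odot>\<^bsub>E\<^esub> (r \<odot>\<^bsub>E\<^esub> x) = r \<odot>\<^bsub>E\<^esub> ((-1) \<odot>\<^bsub>E\<^esub> x)" if "x \<in> carrier E" for r :: real and x
    using that by (simp flip: scalar_assoc)
  show ?thesis using assms
    by (simp add: diff_eq_scalar scalar_distrib * M.a_ac)
qed

lemma ndist_comb:
  assumes "a \<in> carrier E" "b \<in> carrier E" "c \<in> carrier E" "d \<in> carrier E" "0 \<le> t" "t \<le> 1"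
  shows "ndist E ((1 - t) \<odot>\<^bsub>E\<^esub> a \<oplus> t \<odot>\<^bsub>E\<^esub> b) ((1 - t) \<odot>\<^bsub>E\<^esub> c \<oplus> t \<odot>\<^bsub>E\<^esub> d)
         \<le> (1 - t) * ndist E a c + t * ndist E b d"
  using assms nrm_triangle[of "(1 - t) \<odot>\<^bsub>E\<^esub> (a \<ominus> c)" "t \<odot>\<^bsub>E\<^esub> (b \<ominus> d)"]
  by (simp add: ndist_eq diff_comb nrm_smult)

lemma comb_same: "x \<in> carrier E \<Longrightarrow> (1 - t) \<odot>\<^bsub>E\<^esub> x \<oplus> t \<odot>\<^bsub>E\<^esub> x = x"
  using scalar_add[of x "1 - t" t] by simp

lemma ndist_comb_point:
  assumes "a \<in> carrier E" "b \<in> carrier E" "w \<in> carrier E" "0 \<le> t" "t \<le> 1"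
  shows "ndist E w ((1 - t) \<odot>\<^bsub>E\<^esub> a \<oplus> t \<odot>\<^bsub>E\<^esub> b) \<le> (1 - t) * ndist E w a + t * ndist E w b"
  using ndist_comb[of w w a b t] assms by (simp add: comb_same)

lemma ndist_translate:
  assumes "a \<in> carrier E" "b \<in> carrier E" "h \<in> carrier E"
  shows "ndist E (a \<oplus> h) (b \<oplus> h) = ndist E a b"
proof -
  have "(a \<oplus> h) \<ominus> (b \<oplus> h) = a \<ominus> b"
    using diff_comb[of a h b h 1 1] assms by (simp add: M.minus_eq M.r_neg)
  with assms show ?thesis by (simp add: ndist_eq)
qed

lemma add_diff_cancel: "a \<in> carrier E \<Longrightarrow> h \<in> carrier E \<Longrightarrow> (a \<oplus> h) \<ominus> a = h"
  by (simp add: M.minus_eq M.a_comm[of a h] M.a_assoc M.r_neg)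

lemma ndist_shift: "a \<in> carrier E \<Longrightarrow> h \<in> carrier E \<Longrightarrow> ndist E (a \<oplus> h) a = nrm E h"
  by (simp add: ndist_eq add_diff_cancel)

lemma ndist_shift_le:
  assumes "w \<in> carrier E" "a \<in> carrier E" "h \<in> carrier E"
  shows "ndist E w (a \<oplus> h) \<le> ndist E w a + nrm E h"
  using metric.triangle[of w a "a \<oplus> h"] metric.commute[of a "a \<oplus> h"] assms
  by (simp add: ndist_shift)

lemma nconvex_carrier: "nconvex E (carrier E)"
  by (simp add: nconvex_def)

subsection \<open>Lower semicontinuity\<close>

lemma LSC_iff:
  "f \<in> LSC E \<longleftrightarrow> (\<forall>x. f x \<noteq> -\<infinity>) \<and> (\<forall>x. x \<notin> carrier E \<longrightarrow> f x = \<infinity>) \<and>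
     (\<forall>x\<in>carrier E. \<forall>a. a < f x \<longrightarrow> (\<exists>r>0. \<forall>y\<in>carrier E. ndist E x y < r \<longrightarrow> a < f y))"
proof -
  have "(\<forall>a<f x. \<forall>\<^sub>F y in atin metric.mtopology x. a < f y) \<longleftrightarrow>
        (\<forall>a. a < f x \<longrightarrow> (\<exists>r>0. \<forall>y\<in>carrier E. ndist E x y < r \<longrightarrow> a < f y))"
    if "x \<in> carrier E" for x
  proof (intro all_cong)
    fix a assume a: "a < f x"
    show "(\<forall>\<^sub>F y in atin metric.mtopology x. a < f y) \<longleftrightarrow>
          (\<exists>r>0. \<forall>y\<in>carrier E. ndist E x y < r \<longrightarrow> a < f y)"
      unfolding metric.eventually_atin_metric using that a
      by (metis metric.commute metric.mdist_pos_eq)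
  qed
  then show ?thesis by (simp add: LSC_def le_Liminf_iff)
qed

lemma LSC_lower_bound:
  assumes "f \<in> LSC E" "x \<in> carrier E" "a < f x"
  obtains r where "r > 0" "\<And>y. y \<in> carrier E \<Longrightarrow> ndist E x y < r \<Longrightarrow> a < f y"
  using assms unfolding LSC_iff by blast

lemma ext_LSC:
  assumes "nlipschitz E \<phi>" shows "ext E \<phi> \<in> LSC E"
proof -
  obtain L where L: "\<And>x y. x \<in> carrier E \<Longrightarrow> y \<in> carrier E \<Longrightarrow> \<bar>\<phi> x - \<phi> y\<bar> \<le> L * ndist E x y"
    using assms unfolding nlipschitz_def by blast
  have "\<exists>r>0. \<forall>y\<in>carrier E. ndist E x y < r \<longrightarrow> a < ext E \<phi> y"
    if x: "x \<in> carrier E" and a: "a < ext E \<phi> x" for x a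
  proof -
    obtain b where b: "a \<le> ereal b" "b < \<phi> x"
      using a x by (cases a) (auto simp: ext_def intro: that[of "\<phi> x - 1"])
    define r where "r = (\<phi> x - b) / (\<bar>L\<bar> + 1)"
    have "r > 0" using b by (simp add: r_def)
    moreover have "a < ext E \<phi> y" if y: "y \<in> carrier E" "ndist E x y < r" for y
    proof -
      have "\<phi> x - \<phi> y \<le> L * ndist E x y" using L[OF x y(1)] by simp
      also have "\<dots> \<le> (\<bar>L\<bar> + 1) * ndist E x y" by (intro mult_right_mono) auto
      also have "\<dots> < (\<bar>L\<bar> + 1) * r" using y by (intro mult_strict_left_mono) auto
      also have "\<dots> = \<phi> x - b" by (simp add: r_def)
      finally have "b < \<phi> y" by simp
      with b y show ?thesis by (auto simp: ext_def intro: le_less_trans)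
    qed
    ultimately show ?thesis by blast
  qed
  then show ?thesis unfolding LSC_iff by (auto simp: ext_def)
qed

subsection \<open>Continuous linear functionals\<close>

lemma dualD:
  assumes "l \<in> dual E"
  shows dual_off: "x \<notin> carrier E \<Longrightarrow> l x = 0"
    and dual_add: "x \<in> carrier E \<Longrightarrow> y \<in> carrier E \<Longrightarrow> l (x \<oplus> y) = l x + l y"
    and dual_scalar: "x \<in> carrier E \<Longrightarrow> l (c \<odot>\<^bsub>E\<^esub> x) = c * l x"
  using assms by (auto simp: dual_def)

lemma dual_zero: "l \<in> dual E \<Longrightarrow> l \<zero> = 0"
  using dual_scalar[of l \<zero> 0] by simp

lemma dual_diff: "l \<in> dual E \<Longrightarrow> x \<in> carrier E \<Longrightarrow> y \<in> carrier E \<Longrightarrow> l (x \<ominus> y) = l x - l y"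
  by (simp add: diff_eq_scalar dual_add dual_scalar)

lemma dual_plus:
  assumes "l \<in> dual E" "m \<in> dual E" shows "(\<lambda>v. l v + m v) \<in> dual E"
proof -
  obtain C D where C: "\<And>x. x \<in> carrier E \<Longrightarrow> \<bar>l x\<bar> \<le> C * nrm E x"
    and D: "\<And>x. x \<in> carrier E \<Longrightarrow> \<bar>m x\<bar> \<le> D * nrm E x"
    using assms unfolding dual_def mem_Collect_eq by metis
  have "\<bar>l x + m x\<bar> \<le> (C + D) * nrm E x" if "x \<in> carrier E" for x
    using C[OF that] D[OF that] by (simp add: distrib_right)
  then have "\<exists>C. \<forall>x\<in>carrier E. \<bar>l x + m x\<bar> \<le> C * nrm E x" by blast
  with assms show ?thesis unfolding dual_def by (simp add: algebra_simps)
qed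

lemma dual_minus: "l \<in> dual E \<Longrightarrow> (\<lambda>v. - l v) \<in> dual E"
  by (auto simp: dual_def)

lemma dual_sum: "finite I \<Longrightarrow> (\<And>i. i \<in> I \<Longrightarrow> l i \<in> dual E) \<Longrightarrow> (\<lambda>v. \<Sum>i\<in>I. l i v) \<in> dual E"
proof (induction I rule: finite_induct)
  case empty
  show ?case by (auto simp: dual_def intro!: exI[of _ 0])
next
  case (insert i I)
  then show ?case using dual_plus[of "l i" "\<lambda>v. \<Sum>i\<in>I. l i v"] by simp
qed

lemma dual_norm_le:
  assumes "0 \<le> C" "\<And>x. x \<in> carrier E \<Longrightarrow> \<bar>l x\<bar> \<le> C * nrm E x"
  shows "dual_norm E l \<le> C"
  unfolding dual_norm_def
proof (rule cSUP_least)
  show "{x \<in> carrier E. nrm E x \<le> 1} \<noteq> {}" by (auto intro!: exI[of _ \<zero>])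
  fix x assume "x \<in> {x \<in> carrier E. nrm E x \<le> 1}"
  with assms(2)[of x] mult_left_mono[of "nrm E x" 1 C] assms(1) show "\<bar>l x\<bar> \<le> C" by simp
qed

lemma dual_bdd:
  assumes "l \<in> dual E"
  shows "bdd_above ((\<lambda>x. \<bar>l x\<bar>) ` {x \<in> carrier E. nrm E x \<le> 1})"
proof -
  obtain C where C: "\<And>x. x \<in> carrier E \<Longrightarrow> \<bar>l x\<bar> \<le> C * nrm E x"
    using assms unfolding dual_def by blast
  have "\<bar>l x\<bar> \<le> \<bar>C\<bar>" if "x \<in> carrier E" "nrm E x \<le> 1" for x
    using C[OF that(1)] mult_mono[of C "\<bar>C\<bar>" "nrm E x" 1] that nrm_nonneg[OF that(1)] by linarith
  then show ?thesis by (intro bdd_aboveI2[of _ _ "\<bar>C\<bar>"]) auto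
qed

lemma dual_norm_nonneg: "l \<in> dual E \<Longrightarrow> 0 \<le> dual_norm E l"
  unfolding dual_norm_def
  by (rule cSUP_upper2[where x = \<zero>, OF dual_bdd]) auto

lemma dual_norm_bound:
  assumes "l \<in> dual E" "x \<in> carrier E"
  shows "\<bar>l x\<bar> \<le> dual_norm E l * nrm E x"
proof (cases "nrm E x = 0")
  case True
  with assms show ?thesis by (simp add: nrm_eq_0 dual_zero)
next
  case False
  then have pos: "nrm E x > 0" using nrm_nonneg[OF assms(2)] by linarith
  let ?u = "(1 / nrm E x) \<odot>\<^bsub>E\<^esub> x"
  have "\<bar>l ?u\<bar> \<le> dual_norm E l"
    unfolding dual_norm_def
    by (rule cSUP_upper[OF _ dual_bdd[OF assms(1)]]) (use assms pos in \<open>auto simp: nrm_smult\<close>)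
  moreover have "\<bar>l ?u\<bar> = \<bar>l x\<bar> / nrm E x" using assms pos by (simp add: dual_scalar)
  ultimately show ?thesis using pos by (simp add: field_simps)
qed

lemma dual_lipschitz: "l \<in> dual E \<Longrightarrow> nlipschitz E l"
  unfolding nlipschitz_def
  by (intro exI[of _ "dual_norm E l"])
    (metis M.minus_closed dual_diff dual_norm_bound ndist_eq)

text \<open>One-sided estimates suffice for a linear functional, because \<open>h\<close> may be replaced by \<open>- h\<close>.\<close>

lemma dual_abs_le:
  assumes "l \<in> dual E" "\<And>h. h \<in> carrier E \<Longrightarrow> l h \<le> C * nrm E h" "x \<in> carrier E"
  shows "\<bar>l x\<bar> \<le> C * nrm E x"
  using assms(2)[of x] assms(2)[of "(-1) \<odot>\<^bsub>E\<^esub> x"] assms(1,3) by (simp add: dual_scalar nrm_smult)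

end

section \<open>Ekeland's variational principle\<close>

context Metric_space
begin

text \<open>
  The second conclusion keeps \<open>z\<close> near \<open>x0\<close> when \<open>x0\<close> almost minimizes \<open>G\<close>, and the
  third says that \<open>z\<close> minimizes \<open>G\<close> perturbed by a cone of small slope.

  The sets \<open>S u\<close> of points lying below the cone of slope \<open>- \<kappa>\<close> with apex \<open>(u, G u)\<close> shrink as
  one passes to points of them. Choosing almost minimal points successively makes their
  diameters tend to 0, so that by completeness they have a common point. The set \<open>A\<close> serves as the
  effective domain of a function with values in \<open>\<real> \<union> {+\<infinity>}\<close>.
\<close>

theorem ekeland:
  fixes G :: "'a \<Rightarrow> real"
  assumes complete: "mcomplete"
    and lsc: "\<And>a. closedin mtopology {x \<in> A. G x \<le> a}"
    and low: "\<And>x. x \<in> A \<Longrightarrow> m \<le> G x"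
    and x0: "x0 \<in> A" and \<kappa>: "\<kappa> > 0"
  obtains z where "z \<in> A" "G z + \<kappa> * d x0 z \<le> G x0"
    "\<And>y. y \<in> A \<Longrightarrow> G z \<le> G y + \<kappa> * d z y"
proof -
  have AM: "A \<subseteq> M"
  proof
    fix x assume "x \<in> A"
    then show "x \<in> M" using closedin_subset[OF lsc[of "G x"]] by auto
  qed
  define S where "S u = {y \<in> A. G y + \<kappa> * d u y \<le> G u}" for u
  have S_self: "u \<in> S u" if "u \<in> A" for u using that AM by (auto simp: S_def)
  have S_mono: "S v \<subseteq> S u" if "v \<in> S u" "u \<in> A" for u v
  proof
    fix y assume y: "y \<in> S v"
    have "d u y \<le> d u v + d v y" using that y AM by (intro triangle) (auto simp: S_def)
    then have "\<kappa> * d u y \<le> \<kappa> * d u v + \<kappa> * d v y" using \<kappa> by (simp flip: distrib_left)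
    with that y show "y \<in> S u" by (auto simp: S_def)
  qed
  have S_closed: "closedin mtopology (S u)" if u: "u \<in> A" for u
    unfolding closedin_metric
  proof (intro conjI allI impI)
    show "S u \<subseteq> M" using AM by (auto simp: S_def)
    fix y assume y: "y \<in> M - S u"
    \<comment> \<open>Near \<open>y\<close> one has \<open>G > a\<close> on \<open>A\<close> and \<open>\<kappa> * d u _\<close> exceeds \<open>G u - a\<close>.\<close>
    obtain a where a: "G u - \<kappa> * d u y < a" "y \<notin> {x \<in> A. G x \<le> a}"
    proof (cases "y \<in> A")
      case True
      then have "G u - \<kappa> * d u y < G y" using y by (auto simp: S_def)
      then obtain a where "G u - \<kappa> * d u y < a" "a < G y" using dense by blast
      then show ?thesis using that[of a] by auto
    next
      case False
      then show ?thesis using that[of "G u - \<kappa> * d u y + 1"] by auto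
    qed
    obtain r where r: "r > 0" "disjnt {x \<in> A. G x \<le> a} (mball y r)"
      using lsc[of a] a y unfolding closedin_metric by blast
    define q where "q = (a - (G u - \<kappa> * d u y)) / \<kappa>"
    have q: "q > 0" using a \<kappa> by (simp add: q_def)
    have "v \<notin> S u" if v: "v \<in> mball y (min r q)" for v
    proof
      assume vS: "v \<in> S u"
      then have "v \<in> A" by (simp add: S_def)
      then have "a < G v" using r v unfolding disjnt_iff by force
      moreover have "d u y \<le> d u v + d v y" using u y v AM by (intro triangle) auto
      then have "\<kappa> * d u y \<le> \<kappa> * d u v + \<kappa> * d v y" using \<kappa> by (simp flip: distrib_left)
      moreover have "\<kappa> * d v y < \<kappa> * q" using v \<kappa> commute[of v y] by simp
      then have "\<kappa> * d v y < a - (G u - \<kappa> * d u y)" using \<kappa> by (simp add: q_def)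
      ultimately show False using vS by (simp add: S_def)
    qed
    then show "\<exists>r>0. disjnt (S u) (mball y r)"
      using r q by (intro exI[of _ "min r q"]) (auto simp: disjnt_iff)
  qed
  have "\<exists>v. v \<in> S u \<and> (\<forall>y\<in>S u. G v \<le> G y + e)" if "u \<in> A" "e > 0" for u e
  proof -
    have bdd: "bdd_below (G ` S u)" using low by (intro bdd_belowI2[of _ m]) (auto simp: S_def)
    have ne: "G ` S u \<noteq> {}" using S_self[OF that(1)] by auto
    obtain v where "v \<in> S u" "G v < Inf (G ` S u) + e"
      using cInf_lessD[OF ne, of "Inf (G ` S u) + e"] \<open>e > 0\<close> by force
    moreover have "Inf (G ` S u) \<le> G y" if "y \<in> S u" for y using that bdd by (intro cInf_lower) auto
    ultimately show ?thesis by (intro exI[of _ v]) force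
  qed
  then obtain next_pt where np: "\<And>u e. u \<in> A \<Longrightarrow> e > 0 \<Longrightarrow>
      next_pt u e \<in> S u \<and> (\<forall>y\<in>S u. G (next_pt u e) \<le> G y + e)"
    by metis
  define x where "x = rec_nat x0 (\<lambda>n u. next_pt u (inverse (real (Suc n))))"
  have x_simps: "x 0 = x0" "x (Suc n) = next_pt (x n) (inverse (real (Suc n)))" for n
    by (simp_all add: x_def)
  have xA: "x n \<in> A" for n
  proof (induction n)
    case (Suc n)
    then show ?case using np[of "x n" "inverse (real (Suc n))"] by (simp add: x_simps S_def)
  qed (simp add: x_simps x0)
  have x_step: "x (Suc n) \<in> S (x n)"
    and x_min: "y \<in> S (x n) \<Longrightarrow> G (x (Suc n)) \<le> G y + inverse (real (Suc n))" for n y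
    using np[OF xA, of "inverse (real (Suc n))" n] by (auto simp: x_simps)
  have dec: "decseq (\<lambda>n. S (x n))"
    by (intro decseq_SucI S_mono x_step xA)
  have small: "\<exists>n a. S (x n) \<subseteq> mcball a e" if "e > 0" for e
  proof -
    obtain n where n: "inverse (real (Suc n)) < \<kappa> * e"
      using reals_Archimedean[OF mult_pos_pos[OF \<kappa> \<open>e > 0\<close>]] by blast
    have "S (x (Suc n)) \<subseteq> mcball (x (Suc n)) e"
    proof
      fix y assume y: "y \<in> S (x (Suc n))"
      then have "y \<in> S (x n)" using S_mono[OF x_step xA] by blast
      then have "\<kappa> * d (x (Suc n)) y \<le> \<kappa> * e"
        using x_min[of y n] y n by (simp add: S_def)
      then show "y \<in> mcball (x (Suc n)) e" using y xA[of "Suc n"] AM \<kappa> by (auto simp: S_def)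
    qed
    then show ?thesis by blast
  qed
  have "\<Inter> (range (\<lambda>n. S (x n))) \<noteq> {}"
    using complete[unfolded mcomplete_nest, rule_format, of "\<lambda>n. S (x n)"] dec small S_closed[OF xA] S_self[OF xA]
    by blast
  then obtain z where z: "\<And>n. z \<in> S (x n)" by auto
  have zA: "z \<in> A" using z[of 0] by (simp add: S_def)
  have "G z \<le> G y + \<kappa> * d z y" if y: "y \<in> A" for y
  proof (rule ccontr)
    assume "\<not> ?thesis"
    then have lt: "G y + \<kappa> * d z y < G z" by simp
    then have "y \<in> S z" using y by (simp add: S_def)
    then have yS: "y \<in> S (x n)" for n using S_mono[OF z xA] by blast
    have "0 \<le> \<kappa> * d z y" using \<kappa> by simp
    then have "0 < G z - G y" using lt by linarith
    then obtain n where "inverse (real (Suc n)) < G z - G y"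
      using reals_Archimedean by blast
    moreover have "G z \<le> G (x (Suc n))"
    proof -
      have "0 \<le> \<kappa> * d (x (Suc n)) z" using \<kappa> by simp
      then show ?thesis using z[of "Suc n"] unfolding S_def by simp
    qed
    ultimately show False using x_min[OF yS[of n]] by simp
  qed
  moreover have "G z + \<kappa> * d x0 z \<le> G x0" using z[of 0] by (simp add: S_def x_simps)
  ultimately show ?thesis using that zA by blast
qed

end

section \<open>Powers of a Banach space\<close>

text \<open>
  The \<open>k\<close>-th power is formed for \<open>k \<ge> 1\<close>; at \<open>k = 0\<close> it is given the same value as at \<open>k = 1\<close>.
\<close>

primrec pow_space :: "'a uni nvs \<Rightarrow> nat \<Rightarrow> 'a uni nvs" where
  "pow_space E 0 = E"
| "pow_space E (Suc k) = (if k = 0 then E else prod_space (pow_space E k) E)"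

primrec coord :: "nat \<Rightarrow> nat \<Rightarrow> 'a uni \<Rightarrow> 'a uni" where
  "coord 0 i u = u"
| "coord (Suc k) i u = (if k = 0 then u else if i = Suc k then rgt u else coord k i (lft u))"

primrec tup :: "nat \<Rightarrow> (nat \<Rightarrow> 'a uni) \<Rightarrow> 'a uni" where
  "tup 0 x = x 1"
| "tup (Suc k) x = (if k = 0 then x 1 else Pr (tup k x) (x (Suc k)))"

primrec pow_sum :: "(nat \<Rightarrow> 'a uni \<Rightarrow> ereal) \<Rightarrow> nat \<Rightarrow> 'a uni \<Rightarrow> ereal" where
  "pow_sum f 0 = f 1"
| "pow_sum f (Suc k) = (if k = 0 then f 1 else sep_sum (pow_sum f k) (f (Suc k)))"

lemma prod_space_simps:
  "carrier (prod_space E G) = {Pr x y | x y. x \<in> carrier E \<and> y \<in> carrier G}"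
  "u \<oplus>\<^bsub>prod_space E G\<^esub> v = Pr (lft u \<oplus>\<^bsub>E\<^esub> lft v) (rgt u \<oplus>\<^bsub>G\<^esub> rgt v)"
  "c \<odot>\<^bsub>prod_space E G\<^esub> u = Pr (c \<odot>\<^bsub>E\<^esub> lft u) (c \<odot>\<^bsub>G\<^esub> rgt u)"
  "nrm (prod_space E G) u = max (nrm E (lft u)) (nrm G (rgt u))"
  by (simp_all add: prod_space_def)

lemma Suc_cases_atLeastAtMost: "i \<in> {1..Suc k} \<Longrightarrow> i = Suc k \<or> i \<in> {1..k}"
  by auto

lemma coord_carrier:
  "1 \<le> k \<Longrightarrow> u \<in> carrier (pow_space E k) \<Longrightarrow> i \<in> {1..k} \<Longrightarrow> coord k i u \<in> carrier E"
proof (induction k arbitrary: u rule: nat_induct_at_least)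
  case (Suc k)
  then show ?case by (auto simp: prod_space_simps dest: Suc_cases_atLeastAtMost)
qed simp

lemma tup_carrier:
  "1 \<le> k \<Longrightarrow> (\<And>i. i \<in> {1..k} \<Longrightarrow> x i \<in> carrier E) \<Longrightarrow> tup k x \<in> carrier (pow_space E k)"
  by (induction k rule: nat_induct_at_least) (auto simp: prod_space_simps)

lemma coord_tup: "1 \<le> k \<Longrightarrow> i \<in> {1..k} \<Longrightarrow> coord k i (tup k x) = x i"
proof (induction k rule: nat_induct_at_least)
  case (Suc k)
  then show ?case by (auto dest: Suc_cases_atLeastAtMost)
qed simp

lemma coord_add:
  "1 \<le> k \<Longrightarrow> i \<in> {1..k} \<Longrightarrow> coord k i (u \<oplus>\<^bsub>pow_space E k\<^esub> v) = coord k i u \<oplus>\<^bsub>E\<^esub> coord k i v"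
proof (induction k arbitrary: u v rule: nat_induct_at_least)
  case (Suc k)
  then show ?case by (auto simp: prod_space_simps dest: Suc_cases_atLeastAtMost)
qed simp

lemma coord_scalar:
  "1 \<le> k \<Longrightarrow> i \<in> {1..k} \<Longrightarrow> coord k i (c \<odot>\<^bsub>pow_space E k\<^esub> u) = c \<odot>\<^bsub>E\<^esub> coord k i u"
proof (induction k arbitrary: u rule: nat_induct_at_least)
  case (Suc k)
  then show ?case by (auto simp: prod_space_simps dest: Suc_cases_atLeastAtMost)
qed simp

lemma nrm_pow_le_iff:
  "1 \<le> k \<Longrightarrow> nrm (pow_space E k) u \<le> c \<longleftrightarrow> (\<forall>i\<in>{1..k}. nrm E (coord k i u) \<le> c)"
proof (induction k arbitrary: u rule: nat_induct_at_least)
  case (Suc k)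
  have "{1..Suc k} = insert (Suc k) {1..k}" by auto
  with Suc show ?case by (auto simp: prod_space_simps)
qed simp

lemma ndiam_le_iff:
  assumes "1 \<le> k"
  shows "ndiam E k x \<le> c \<longleftrightarrow> (\<forall>i\<in>{1..k}. \<forall>j\<in>{1..k}. ndist E (x i) (x j) \<le> c)"
proof -
  have eq: "{ndist E (x i) (x j) | i j. i \<in> {1..k} \<and> j \<in> {1..k}}
      = (\<lambda>(i, j). ndist E (x i) (x j)) ` ({1..k} \<times> {1..k})" (is "?A = ?B")
  proof (intro equalityI subsetI)
    fix c assume "c \<in> ?A"
    then obtain i j where "c = ndist E (x i) (x j)" "i \<in> {1..k}" "j \<in> {1..k}" by blast
    then show "c \<in> ?B" by (intro image_eqI[of _ _ "(i, j)"]) simp_all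
  next
    fix c assume "c \<in> ?B"
    then obtain i j where "c = ndist E (x i) (x j)" "i \<in> {1..k}" "j \<in> {1..k}" by force
    then show "c \<in> ?A" by blast
  qed
  show ?thesis unfolding ndiam_def eq using assms by (subst Max_le_iff) auto
qed

lemma ndist_le_ndiam:
  "i \<in> {1..k} \<Longrightarrow> j \<in> {1..k} \<Longrightarrow> ndist E (x i) (x j) \<le> ndiam E k x"
  using ndiam_le_iff[of k E x "ndiam E k x"] by force

text \<open>
  Strict lower bounds of a sum come from strict lower bounds of the summands, which reduces lower
  semicontinuity of a sum to that of its terms, infinite values included.
\<close>

lemma ereal_less_add_split:
  fixes p q a :: ereal
  assumes "a < p + q" "p \<noteq> -\<infinity>" "q \<noteq> -\<infinity>"
  obtains b c where "b < p" "c < q" "a \<le> b + c"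
proof (cases "a = -\<infinity>")
  case True
  then show ?thesis using that[of "-\<infinity>" "-\<infinity>"] assms by auto
next
  case False
  then obtain a' where a: "a = ereal a'" using assms(1) by (cases a) auto
  show ?thesis
  proof (cases p)
    case (real p')
    show ?thesis
    proof (cases q)
      case (real q')
      with \<open>p = ereal p'\<close> a assms show ?thesis
        by (intro that[of "ereal (p' - (p' + q' - a') / 2)" "ereal (q' - (p' + q' - a') / 2)"])
          (auto simp: field_simps)
    next
      case PInf
      with \<open>p = ereal p'\<close> a show ?thesis
        by (intro that[of "ereal (p' - 1)" "ereal (a' - p' + 1)"]) auto
    qed (use assms in auto)
  next
    case PInf
    show ?thesis
    proof (cases q)
      case (real q')
      with PInf a show ?thesis
        by (intro that[of "ereal (a' - q' + 1)" "ereal (q' - 1)"]) auto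
    next
      case PInf
      with \<open>p = \<infinity>\<close> a show ?thesis
        by (intro that[of "ereal a'" "ereal 0"]) auto
    qed (use assms in auto)
  qed (use assms in auto)
qed

lemma sep_sum_LSC:
  assumes E: "banach_space E" and G: "banach_space G" and P: "banach_space (prod_space E G)"
    and f: "f \<in> LSC E" and g: "g \<in> LSC G"
  shows "sep_sum f g \<in> LSC (prod_space E G)"
proof -
  interpret E: banach_space E by (rule E)
  interpret G: banach_space G by (rule G)
  interpret P: banach_space "prod_space E G" by (rule P)
  have fN: "f x \<noteq> -\<infinity>" "x \<notin> carrier E \<Longrightarrow> f x = \<infinity>" for x
    using f unfolding E.LSC_iff by auto
  have gN: "g x \<noteq> -\<infinity>" "x \<notin> carrier G \<Longrightarrow> g x = \<infinity>" for x
    using g unfolding G.LSC_iff by auto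
  have ndist: "ndist (prod_space E G) (Pr x y) (Pr x' y') = max (ndist E x x') (ndist G y y')"
    if "x \<in> carrier E" "y \<in> carrier G" "x' \<in> carrier E" "y' \<in> carrier G" for x y x' y'
    using that P.diff_eq_scalar[of "Pr x y" "Pr x' y'"]
    by (simp add: ndist_def prod_space_simps E.diff_eq_scalar G.diff_eq_scalar)
  have "\<exists>r>0. \<forall>v\<in>carrier (prod_space E G). ndist (prod_space E G) u v < r \<longrightarrow> a < sep_sum f g v"
    if u: "u \<in> carrier (prod_space E G)" and a: "a < sep_sum f g u" for u a
  proof -
    from u obtain x y where xy: "u = Pr x y" "x \<in> carrier E" "y \<in> carrier G"
      by (auto simp: prod_space_simps)
    then obtain b c where bc: "b < f x" "c < g y" "a \<le> b + c"
      using ereal_less_add_split[of a "f x" "g y"] a fN(1) gN(1) by (auto simp: sep_sum_def)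
    obtain r where r: "r > 0" "\<And>x'. x' \<in> carrier E \<Longrightarrow> ndist E x x' < r \<Longrightarrow> b < f x'"
      using E.LSC_lower_bound[OF f xy(2) bc(1)] by blast
    obtain s where s: "s > 0" "\<And>y'. y' \<in> carrier G \<Longrightarrow> ndist G y y' < s \<Longrightarrow> c < g y'"
      using G.LSC_lower_bound[OF g xy(3) bc(2)] by blast
    have "a < sep_sum f g v"
      if v: "v \<in> carrier (prod_space E G)" "ndist (prod_space E G) u v < min r s" for v
    proof -
      from v(1) obtain x' y' where v': "v = Pr x' y'" "x' \<in> carrier E" "y' \<in> carrier G"
        by (auto simp: prod_space_simps)
      then have "b < f x'" "c < g y'" using r s v(2) xy by (auto simp: ndist)
      then have "b + c < f x' + g y'" by (rule ereal_add_strict_mono2)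
      with bc(3) v' show ?thesis by (simp add: sep_sum_def)
    qed
    then show ?thesis using r s by (intro exI[of _ "min r s"]) auto
  qed
  moreover have "sep_sum f g u \<noteq> -\<infinity>" for u
    using fN(1) gN(1) by (cases u) (auto simp: sep_sum_def)
  moreover have "sep_sum f g u = \<infinity>" if "u \<notin> carrier (prod_space E G)" for u
    using that fN(2) gN(2) by (cases u) (auto simp: sep_sum_def prod_space_simps)
  ultimately show ?thesis unfolding P.LSC_iff by blast
qed

lemma subdifferential_subset_dual:
  assumes "subdifferential D" "banach_space E" "f \<in> LSC E" "x \<in> carrier E"
  shows "D E f x \<subseteq> dual E"
  by (rule assms(1)[unfolded subdifferential_def, THEN conjunct1, rule_format]) (use assms in simp)

text \<open>
  For functions that are convex on the whole space, any subdifferential is that of convex analysis: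
  the whole space is a convex neighbourhood of each of its points.
\<close>

lemma subdifferential_lipschitz_convex:
  fixes E (structure)
  assumes D: "subdifferential D" and E: "banach_space E" and lip: "nlipschitz E \<phi>"
    and conv: "nconvex_on E (carrier E) (ext E \<phi>)" and x: "x \<in> carrier E"
  shows "D E (ext E \<phi>) x = {l \<in> dual E. \<forall>v\<in>carrier E. l (v \<ominus> x) + \<phi> x \<le> \<phi> v}"
proof -
  interpret banach_space E by (rule E)
  have int: "x \<in> metric.mtopology interior_of (carrier E)"
    using x interior_of_topspace[of metric.mtopology] by simp
  have "D E (ext E \<phi>) x
      = {l \<in> dual E. \<forall>v\<in>carrier E. ereal (l (v \<ominus> x)) + ext E \<phi> x \<le> ext E \<phi> v}"
    using D[unfolded subdifferential_def, THEN conjunct2, THEN conjunct1, rule_format,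
        of E "ext E \<phi>" x "carrier E"]
      E ext_LSC[OF lip] x nconvex_carrier int conv
    by (simp add: ext_def)
  then show ?thesis using x by (simp add: ext_def)
qed

locale banach_powers =
  fixes E :: "'a uni nvs" (structure)
  assumes banach_pow: "banach_space (pow_space E k)"
begin

sublocale banach_space E
  using banach_pow[of 0] by simp

abbreviation pdiam :: "nat \<Rightarrow> 'a uni \<Rightarrow> real" where
  "pdiam k u \<equiv> ndiam E k (\<lambda>i. coord k i u)"

abbreviation diag :: "nat \<Rightarrow> 'a uni \<Rightarrow> 'a uni" where
  "diag k h \<equiv> tup k (\<lambda>_. h)"

lemma pow_sum_LSC:
  assumes "1 \<le> k" "\<And>i. i \<in> {1..k} \<Longrightarrow> f i \<in> LSC E"
  shows "pow_sum f k \<in> LSC (pow_space E k)"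
  using assms
proof (induction k rule: nat_induct_at_least)
  case (Suc k)
  then show ?case
    using sep_sum_LSC[of "pow_space E k" E "pow_sum f k" "f (Suc k)"]
      banach_pow[of k] banach_pow[of "Suc k"] banach_pow[of 0] by simp
qed simp

lemma pow_sum_eq:
  assumes "1 \<le> k" "u \<in> carrier (pow_space E k)"
  shows "pow_sum f k u = (\<Sum>i=1..k. f i (coord k i u))"
  using assms
proof (induction k arbitrary: u rule: nat_induct_at_least)
  case (Suc k)
  then show ?case by (auto simp: prod_space_simps sep_sum_def)
qed simp

text \<open>
  The axiom on separable sums concerns two factors. As powers are iterated products, induction on
  the number of factors extends it to all of them.
\<close>

lemma subdiff_pow_sum:
  assumes "subdifferential D" "1 \<le> k" "\<And>i. i \<in> {1..k} \<Longrightarrow> f i \<in> LSC E"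
    and "u \<in> carrier (pow_space E k)" "l \<in> D (pow_space E k) (pow_sum f k) u"
  shows "\<exists>m. (\<forall>i\<in>{1..k}. m i \<in> D E (f i) (coord k i u)) \<and>
             (\<forall>v\<in>carrier (pow_space E k). l v = (\<Sum>i=1..k. m i (coord k i v)))"
  using assms(2-)
proof (induction k arbitrary: u l rule: nat_induct_at_least)
  case base
  then show ?case by (intro exI[of _ "\<lambda>_. l"]) simp
next
  case (Suc k)
  let ?P = "pow_space E k"
  have P: "pow_space E (Suc k) = prod_space ?P E" "pow_sum f (Suc k) = sep_sum (pow_sum f k) (f (Suc k))"
    using Suc.hyps by auto
  from Suc.prems(2) obtain a b where ab: "u = Pr a b" "a \<in> carrier ?P" "b \<in> carrier E"
    unfolding P by (auto simp: prod_space_simps)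
  have fs: "pow_sum f k \<in> LSC ?P" using Suc by (intro pow_sum_LSC) auto
  have "D (prod_space ?P E) (sep_sum (pow_sum f k) (f (Suc k))) (Pr a b)
        \<subseteq> {dual_pair ?P E l m | l m. l \<in> D ?P (pow_sum f k) a \<and> m \<in> D E (f (Suc k)) b}"
    using assms(1) banach_pow[of k] banach_pow[of 0] fs Suc.prems(1)[of "Suc k"] ab
    unfolding subdifferential_def by simp
  then obtain p q where pq: "l = dual_pair ?P E p q" "p \<in> D ?P (pow_sum f k) a" "q \<in> D E (f (Suc k)) b"
    using Suc.prems(3) unfolding P ab by blast
  obtain m where m: "\<And>i. i \<in> {1..k} \<Longrightarrow> m i \<in> D E (f i) (coord k i a)"
      "\<And>v. v \<in> carrier ?P \<Longrightarrow> p v = (\<Sum>i=1..k. m i (coord k i v))"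
    using Suc.IH[OF _ ab(2) pq(2)] Suc.prems(1) by (metis Suc_eq_plus1 atLeastAtMost_iff le_SucI)
  let ?m = "m(Suc k := q)"
  have "\<forall>i\<in>{1..Suc k}. ?m i \<in> D E (f i) (coord (Suc k) i u)"
    using m(1) pq(3) ab Suc.hyps by auto
  moreover have "l v = (\<Sum>i=1..Suc k. ?m i (coord (Suc k) i v))"
    if v: "v \<in> carrier (pow_space E (Suc k))" for v
  proof -
    from v obtain c d where v': "v = Pr c d" "c \<in> carrier ?P" "d \<in> carrier E"
      unfolding P by (auto simp: prod_space_simps)
    have "l v = p c + q d" using v' by (simp add: pq(1) dual_pair_def prod_space_simps)
    then show ?thesis using v' Suc.hyps by (simp add: m(2))
  qed
  ultimately show ?case by blast
qed

context
  fixes k :: nat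
  assumes k: "1 \<le> k"
begin

interpretation P: banach_space "pow_space E k"
  by (rule banach_pow)

lemma ndist_pow_le_iff:
  assumes "u \<in> carrier (pow_space E k)" "v \<in> carrier (pow_space E k)"
  shows "ndist (pow_space E k) u v \<le> c \<longleftrightarrow> (\<forall>i\<in>{1..k}. ndist E (coord k i u) (coord k i v) \<le> c)"
proof -
  have "nrm E (coord k i (u \<ominus>\<^bsub>pow_space E k\<^esub> v)) = ndist E (coord k i u) (coord k i v)" if "i \<in> {1..k}" for i
    using that coord_carrier[OF k assms(1) that] coord_carrier[OF k assms(2) that] assms
    by (simp add: ndist_def P.diff_eq_scalar diff_eq_scalar coord_add[OF k] coord_scalar[OF k])
  then show ?thesis using assms by (simp add: P.ndist_eq nrm_pow_le_iff[OF k])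
qed

lemma ndist_coord_le:
  assumes "u \<in> carrier (pow_space E k)" "v \<in> carrier (pow_space E k)" "i \<in> {1..k}"
  shows "ndist E (coord k i u) (coord k i v) \<le> ndist (pow_space E k) u v"
  using ndist_pow_le_iff[OF assms(1,2)] assms(3) by blast

lemma pdiam_nonneg: "0 \<le> pdiam k u"
  by (rule order_trans[OF metric.nonneg ndist_le_ndiam[of 1 k 1]]) (use k in auto)

lemma pdiam_lipschitz:
  assumes "u \<in> carrier (pow_space E k)" "v \<in> carrier (pow_space E k)"
  shows "pdiam k u \<le> pdiam k v + 2 * ndist (pow_space E k) u v"
  unfolding ndiam_le_iff[OF k]
proof (intro ballI)
  fix i j assume ij: "i \<in> {1..k}" "j \<in> {1..k}"
  let ?c = "\<lambda>i. coord k i"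
  have c: "?c i u \<in> carrier E" "?c j u \<in> carrier E" "?c i v \<in> carrier E" "?c j v \<in> carrier E"
    using assms ij by (simp_all add: coord_carrier[OF k])
  have "ndist E (?c i u) (?c j u)
      \<le> ndist E (?c i u) (?c i v) + (ndist E (?c i v) (?c j v) + ndist E (?c j v) (?c j u))"
    using metric.triangle[OF c(1,3,2)] metric.triangle[OF c(3,4,2)] by simp
  moreover have "ndist E (?c i v) (?c j v) \<le> pdiam k v"
    using ij by (rule ndist_le_ndiam)
  moreover have "ndist E (?c i u) (?c i v) \<le> ndist (pow_space E k) u v"
    "ndist E (?c j v) (?c j u) \<le> ndist (pow_space E k) u v"
    using ndist_coord_le[OF assms(1,2) ij(1)] ndist_coord_le[OF assms(2,1) ij(2)] P.metric.commute[of u v] by auto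
  ultimately show "ndist E (?c i u) (?c j u) \<le> pdiam k v + 2 * ndist (pow_space E k) u v" by linarith
qed

lemma pdiam_comb:
  assumes "u \<in> carrier (pow_space E k)" "v \<in> carrier (pow_space E k)" "0 \<le> t" "t \<le> 1"
  shows "pdiam k ((1 - t) \<odot>\<^bsub>pow_space E k\<^esub> u \<oplus>\<^bsub>pow_space E k\<^esub> t \<odot>\<^bsub>pow_space E k\<^esub> v)
         \<le> (1 - t) * pdiam k u + t * pdiam k v"
  unfolding ndiam_le_iff[OF k]
proof (intro ballI)
  fix i j assume ij: "i \<in> {1..k}" "j \<in> {1..k}"
  let ?w = "(1 - t) \<odot>\<^bsub>pow_space E k\<^esub> u \<oplus>\<^bsub>pow_space E k\<^esub> t \<odot>\<^bsub>pow_space E k\<^esub> v"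
  have "ndist E (coord k i ?w) (coord k j ?w)
      \<le> (1 - t) * ndist E (coord k i u) (coord k j u) + t * ndist E (coord k i v) (coord k j v)"
    using ndist_comb[of "coord k i u" "coord k i v" "coord k j u" "coord k j v" t] assms ij
    by (simp add: coord_add[OF k] coord_scalar[OF k] coord_carrier[OF k])
  also have "\<dots> \<le> (1 - t) * pdiam k u + t * pdiam k v"
    using ij assms by (intro add_mono mult_left_mono ndist_le_ndiam) auto
  finally show "ndist E (coord k i ?w) (coord k j ?w) \<le> (1 - t) * pdiam k u + t * pdiam k v" .
qed

lemma diag_carrier: "h \<in> carrier E \<Longrightarrow> diag k h \<in> carrier (pow_space E k)"
  by (simp add: tup_carrier[OF k])

lemma nrm_diag: "h \<in> carrier E \<Longrightarrow> nrm (pow_space E k) (diag k h) \<le> nrm E h"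
  by (simp add: nrm_pow_le_iff[OF k] coord_tup[OF k])

lemma pdiam_diag: "h \<in> carrier E \<Longrightarrow> pdiam k (diag k h) = 0"
  using pdiam_nonneg[of "diag k h"] ndiam_le_iff[OF k, of E "\<lambda>i. coord k i (diag k h)" 0]
  by (simp add: coord_tup[OF k])

lemma pdiam_add_diag:
  assumes "u \<in> carrier (pow_space E k)" "h \<in> carrier E"
  shows "pdiam k (u \<oplus>\<^bsub>pow_space E k\<^esub> diag k h) \<le> pdiam k u"
  unfolding ndiam_le_iff[OF k]
proof (intro ballI)
  fix i j assume ij: "i \<in> {1..k}" "j \<in> {1..k}"
  then show "ndist E (coord k i (u \<oplus>\<^bsub>pow_space E k\<^esub> diag k h)) (coord k j (u \<oplus>\<^bsub>pow_space E k\<^esub> diag k h))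
        \<le> pdiam k u"
    using assms ndist_le_ndiam[OF ij, of E "\<lambda>i. coord k i u"]
    by (simp add: coord_add[OF k] coord_tup[OF k] ndist_translate coord_carrier[OF k])
qed

text \<open>
  Penalizing the distance of the components makes nearly optimal tuples nearly diagonal. The
  diameter is invariant under diagonal translations, so that however large its weight \<open>N\<close> is, it
  contributes nothing to the sum of the components of a subgradient. The point \<open>c\<close> stands for the
  diagonal tuple of the base point, and the last term for the perturbation from Ekeland's
  principle.
\<close>

definition penalty :: "real \<Rightarrow> real \<Rightarrow> real \<Rightarrow> 'a uni \<Rightarrow> 'a uni \<Rightarrow> 'a uni \<Rightarrow> real" where
  "penalty \<tau> N \<kappa> c z u =
     \<tau> * ndist (pow_space E k) c u + N * pdiam k u + \<kappa> * ndist (pow_space E k) z u"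

context
  fixes \<tau> N \<kappa> :: real and c z :: "'a uni"
  assumes nonneg: "0 \<le> \<tau>" "0 \<le> N" "0 \<le> \<kappa>"
    and centres: "c \<in> carrier (pow_space E k)" "z \<in> carrier (pow_space E k)"
begin

lemma penalty_lipschitz:
  assumes u: "u \<in> carrier (pow_space E k)" and v: "v \<in> carrier (pow_space E k)"
  shows "penalty \<tau> N \<kappa> c z u - penalty \<tau> N \<kappa> c z v \<le> (\<tau> + 2 * N + \<kappa>) * ndist (pow_space E k) u v"
proof -
  have "\<tau> * ndist (pow_space E k) c u \<le> \<tau> * (ndist (pow_space E k) c v + ndist (pow_space E k) u v)"
    "\<kappa> * ndist (pow_space E k) z u \<le> \<kappa> * (ndist (pow_space E k) z v + ndist (pow_space E k) u v)"
    "N * pdiam k u \<le> N * (pdiam k v + 2 * ndist (pow_space E k) u v)"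
    using nonneg P.metric.triangle'[OF centres(1) v u] P.metric.triangle'[OF centres(2) v u]
      pdiam_lipschitz[OF u v]
    by (auto intro!: mult_left_mono)
  then show ?thesis unfolding penalty_def by (simp add: algebra_simps)
qed

lemma penalty_nlipschitz: "nlipschitz (pow_space E k) (penalty \<tau> N \<kappa> c z)"
  unfolding nlipschitz_def
proof (intro exI ballI)
  fix u v assume "u \<in> carrier (pow_space E k)" "v \<in> carrier (pow_space E k)"
  then show "\<bar>penalty \<tau> N \<kappa> c z u - penalty \<tau> N \<kappa> c z v\<bar> \<le> (\<tau> + 2 * N + \<kappa>) * ndist (pow_space E k) u v"
    using penalty_lipschitz[of u v] penalty_lipschitz[of v u] P.metric.commute[of u v] by simp
qed

lemma penalty_convex:
  "nconvex_on (pow_space E k) (carrier (pow_space E k)) (ext (pow_space E k) (penalty \<tau> N \<kappa> c z))"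
  unfolding nconvex_on_def
proof (intro ballI)
  fix u v and t :: real
  assume u: "u \<in> carrier (pow_space E k)" and v: "v \<in> carrier (pow_space E k)" and "t \<in> {0..1}"
  then have t: "0 \<le> t" "t \<le> 1" by auto
  let ?w = "(1 - t) \<odot>\<^bsub>pow_space E k\<^esub> u \<oplus>\<^bsub>pow_space E k\<^esub> t \<odot>\<^bsub>pow_space E k\<^esub> v"
  have "\<tau> * ndist (pow_space E k) c ?w
      \<le> \<tau> * ((1 - t) * ndist (pow_space E k) c u + t * ndist (pow_space E k) c v)"
    "\<kappa> * ndist (pow_space E k) z ?w
      \<le> \<kappa> * ((1 - t) * ndist (pow_space E k) z u + t * ndist (pow_space E k) z v)"
    "N * pdiam k ?w \<le> N * ((1 - t) * pdiam k u + t * pdiam k v)"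
    using nonneg centres u v t by (auto intro!: mult_left_mono P.ndist_comb_point pdiam_comb)
  then have "penalty \<tau> N \<kappa> c z ?w \<le> (1 - t) * penalty \<tau> N \<kappa> c z u + t * penalty \<tau> N \<kappa> c z v"
    unfolding penalty_def by (simp add: algebra_simps)
  then show "ext (pow_space E k) (penalty \<tau> N \<kappa> c z) ?w
      \<le> ereal (1 - t) * ext (pow_space E k) (penalty \<tau> N \<kappa> c z) u
        + ereal t * ext (pow_space E k) (penalty \<tau> N \<kappa> c z) v"
    using u v by (simp add: ext_def)
qed

lemma penalty_diag:
  assumes "u \<in> carrier (pow_space E k)" "h \<in> carrier E"
  shows "penalty \<tau> N \<kappa> c z (u \<oplus>\<^bsub>pow_space E k\<^esub> diag k h) - penalty \<tau> N \<kappa> c z u \<le> (\<tau> + \<kappa>) * nrm E h"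
proof -
  let ?w = "u \<oplus>\<^bsub>pow_space E k\<^esub> diag k h"
  have "ndist (pow_space E k) c ?w \<le> ndist (pow_space E k) c u + nrm E h"
    "ndist (pow_space E k) z ?w \<le> ndist (pow_space E k) z u + nrm E h"
    using P.ndist_shift_le[OF _ assms(1) diag_carrier] nrm_diag assms centres by (meson add_left_mono order_trans)+
  then have "\<tau> * ndist (pow_space E k) c ?w \<le> \<tau> * (ndist (pow_space E k) c u + nrm E h)"
    "\<kappa> * ndist (pow_space E k) z ?w \<le> \<kappa> * (ndist (pow_space E k) z u + nrm E h)"
    "N * pdiam k ?w \<le> N * pdiam k u"
    using nonneg assms by (auto intro!: mult_left_mono pdiam_add_diag)
  then show ?thesis unfolding penalty_def by (simp add: algebra_simps)
qed

text \<open>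
  A subgradient is bounded by the increments of the function, and there are two such bounds here:
  the crude one depends on \<open>N\<close> and holds in all directions, the fine one holds in diagonal
  directions only.
\<close>

lemma penalty_subgradient:
  assumes D: "subdifferential D" and y: "y \<in> carrier (pow_space E k)"
    and m: "m \<in> D (pow_space E k) (ext (pow_space E k) (penalty \<tau> N \<kappa> c z)) y"
  shows "m \<in> dual (pow_space E k)"
    and "h \<in> carrier (pow_space E k) \<Longrightarrow> m h \<le> (\<tau> + 2 * N + \<kappa>) * nrm (pow_space E k) h"
    and "h' \<in> carrier E \<Longrightarrow> m (diag k h') \<le> (\<tau> + \<kappa>) * nrm E h'"
proof -
  let ?\<phi> = "penalty \<tau> N \<kappa> c z"
  let ?P = "pow_space E k"
  have "m \<in> {l \<in> dual ?P. \<forall>v\<in>carrier ?P. l (v \<ominus>\<^bsub>?P\<^esub> y) + ?\<phi> y \<le> ?\<phi> v}"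
    using m unfolding subdifferential_lipschitz_convex[OF D banach_pow penalty_nlipschitz penalty_convex y] .
  then have dual: "m \<in> dual ?P"
    and sub: "\<And>v. v \<in> carrier ?P \<Longrightarrow> m (v \<ominus>\<^bsub>?P\<^esub> y) \<le> ?\<phi> v - ?\<phi> y"
    by force+
  then have grad: "m h \<le> ?\<phi> (y \<oplus>\<^bsub>?P\<^esub> h) - ?\<phi> y" if "h \<in> carrier ?P" for h
    using that y sub[of "y \<oplus>\<^bsub>?P\<^esub> h"] by (simp add: P.add_diff_cancel)
  show "m \<in> dual ?P" by (rule dual)
  show "m h \<le> (\<tau> + 2 * N + \<kappa>) * nrm ?P h" if "h \<in> carrier ?P"
    using grad[OF that] penalty_lipschitz[of "y \<oplus>\<^bsub>?P\<^esub> h" y] that y by (simp add: P.ndist_shift)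
  show "m (diag k h') \<le> (\<tau> + \<kappa>) * nrm E h'" if "h' \<in> carrier E"
    using grad[OF diag_carrier[OF that]] penalty_diag[OF y that] by simp
qed

end

text \<open>
  Here \<open>l\<close> is nearly \<open>- g\<close>, so that both bounds on \<open>g\<close> carry over to \<open>l\<close> up to \<open>e\<close>. On tuples with
  a single nonzero entry \<open>l\<close> acts as the component \<open>m i\<close>, and on the diagonal as the sum of the
  components; both embeddings of \<open>E\<close> are isometric for the maximum norm.
\<close>

lemma components_bound:
  assumes l: "l \<in> dual (pow_space E k)" and m: "\<And>i. i \<in> {1..k} \<Longrightarrow> m i \<in> dual E"
    and lm: "\<And>v. v \<in> carrier (pow_space E k) \<Longrightarrow> l v = (\<Sum>i=1..k. m i (coord k i v))"
    and g: "g \<in> dual (pow_space E k)" and near: "dual_norm (pow_space E k) (\<lambda>v. l v + g v) \<le> e"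
    and L: "\<And>h. h \<in> carrier (pow_space E k) \<Longrightarrow> g h \<le> L * nrm (pow_space E k) h" "0 \<le> L"
    and s: "\<And>h. h \<in> carrier E \<Longrightarrow> g (diag k h) \<le> s * nrm E h" "0 \<le> s" and e: "0 \<le> e"
  shows "i \<in> {1..k} \<Longrightarrow> dual_norm E (m i) \<le> L + e"
    and "dual_norm E (\<lambda>v. \<Sum>i=1..k. m i v) \<le> s + e"
proof -
  let ?P = "pow_space E k"
  have close: "\<bar>l h + g h\<bar> \<le> e * nrm ?P h" if "h \<in> carrier ?P" for h
    using P.dual_norm_bound[OF P.dual_plus[OF l g] that] mult_right_mono[OF near P.nrm_nonneg[OF that]]
    by linarith
  have neg: "(-1) \<odot>\<^bsub>?P\<^esub> h \<in> carrier ?P" "g ((-1) \<odot>\<^bsub>?P\<^esub> h) = - g h" "nrm ?P ((-1) \<odot>\<^bsub>?P\<^esub> h) = nrm ?P h"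
    if "h \<in> carrier ?P" for h
    using that by (auto simp: P.dual_scalar[OF g] P.nrm_smult)
  have lL: "l h \<le> (L + e) * nrm ?P h" if "h \<in> carrier ?P" for h
    using close[OF that] L(1)[OF neg(1)[OF that]] neg[OF that] by (simp add: algebra_simps)
  show "dual_norm E (m i) \<le> L + e" if i: "i \<in> {1..k}"
  proof (rule dual_norm_le)
    show "0 \<le> L + e" using L e by simp
    fix x assume x: "x \<in> carrier E"
    have "m i h \<le> (L + e) * nrm E h" if h: "h \<in> carrier E" for h
    proof -
      let ?t = "tup k (\<lambda>j. if j = i then h else \<zero>)"
      have t: "?t \<in> carrier ?P" using h by (intro tup_carrier[OF k]) auto
      have "l ?t = (\<Sum>j=1..k. if j = i then m i h else 0)"
        unfolding lm[OF t] by (intro sum.cong refl) (use m in \<open>auto simp: coord_tup[OF k] dual_zero\<close>)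
      also have "\<dots> = m i h" using i by simp
      finally have "m i h \<le> (L + e) * nrm ?P ?t" using lL[OF t] by simp
      also have "nrm ?P ?t \<le> nrm E h" using h by (auto simp: nrm_pow_le_iff[OF k] coord_tup[OF k])
      then have "(L + e) * nrm ?P ?t \<le> (L + e) * nrm E h" using L e by (intro mult_left_mono) auto
      finally show ?thesis .
    qed
    then show "\<bar>m i x\<bar> \<le> (L + e) * nrm E x" using dual_abs_le[OF m[OF i] _ x] by blast
  qed
  have dsum: "(\<lambda>v. \<Sum>i=1..k. m i v) \<in> dual E" using m by (intro dual_sum) auto
  have sum_le: "(\<Sum>i=1..k. m i h) \<le> (s + e) * nrm E h" if h: "h \<in> carrier E" for h
  proof -
    have d: "diag k h \<in> carrier ?P" by (rule diag_carrier[OF h])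
    let ?h = "(-1) \<odot>\<^bsub>E\<^esub> h"
    have "(\<Sum>i=1..k. m i h) = l (diag k h)"
      unfolding lm[OF d] by (intro sum.cong refl) (simp add: coord_tup[OF k])
    also have "\<dots> \<le> e * nrm ?P (diag k h) - g (diag k h)" using close[OF d] by simp
    also have "\<dots> \<le> e * nrm E h - g (diag k h)" using nrm_diag[OF h] e by (simp add: mult_left_mono)
    also have "- g (diag k h) = g (diag k ?h)"
    proof -
      have "diag k ?h = (-1) \<odot>\<^bsub>?P\<^esub> diag k h"
        using P.metric.zero[of "diag k ?h" "(-1) \<odot>\<^bsub>?P\<^esub> diag k h"] h d diag_carrier[of ?h]
          ndist_pow_le_iff[of "diag k ?h" "(-1) \<odot>\<^bsub>?P\<^esub> diag k h" 0] P.metric.nonneg[of "diag k ?h" "(-1) \<odot>\<^bsub>?P\<^esub> diag k h"]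
        by (auto simp: coord_tup[OF k] coord_scalar[OF k])
      then show ?thesis using neg(2)[OF d] by simp
    qed
    then have "e * nrm E h - g (diag k h) \<le> (s + e) * nrm E h"
      using s(1)[of ?h] h by (simp add: nrm_smult algebra_simps)
    finally show ?thesis .
  qed
  show "dual_norm E (\<lambda>v. \<Sum>i=1..k. m i v) \<le> s + e"
    using dual_norm_le[of "s + e" "\<lambda>v. \<Sum>i=1..k. m i v"] dual_abs_le[OF dsum sum_le] s e by simp
qed

end

end

section \<open>Slopes and decouplability\<close>

context banach_space
begin

text \<open>
  This closedness is the form of lower semicontinuity in which \<open>ekeland\<close> takes the sum of \<open>f\<close> and
  \<open>\<phi>\<close>, restricted to a closed set.
\<close>

lemma closedin_sublevel:
  assumes f: "f \<in> LSC E" and \<phi>: "nlipschitz E \<phi>" and K: "closedin metric.mtopology K"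
  shows "closedin metric.mtopology {u \<in> K. f u \<le> ereal (a - \<phi> u)}"
  unfolding metric.closedin_metric
proof (intro conjI allI impI)
  show "{u \<in> K. f u \<le> ereal (a - \<phi> u)} \<subseteq> carrier E" using closedin_subset[OF K] by auto
  fix y assume y: "y \<in> carrier E - {u \<in> K. f u \<le> ereal (a - \<phi> u)}"
  show "\<exists>r>0. disjnt {u \<in> K. f u \<le> ereal (a - \<phi> u)} (metric.mball y r)"
  proof (cases "y \<in> K")
    case False
    then obtain r where "r > 0" "disjnt K (metric.mball y r)"
      using K y unfolding metric.closedin_metric by blast
    then show ?thesis by (intro exI[of _ r]) (auto simp: disjnt_iff)
  next
    case True
    with y have "ereal (a - \<phi> y) < f y" by auto
    then obtain b where b: "a - \<phi> y < b" "ereal b < f y" using ereal_dense2[of "ereal (a - \<phi> y)" "f y"] by auto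
    obtain r where r: "r > 0" "\<And>v. v \<in> carrier E \<Longrightarrow> ndist E y v < r \<Longrightarrow> ereal b < f v"
      using LSC_lower_bound[OF f _ b(2)] y by blast
    have "ereal (\<phi> y - (b - (a - \<phi> y))) < ext E \<phi> y" using y b by (simp add: ext_def)
    then obtain s where s: "s > 0"
      "\<And>v. v \<in> carrier E \<Longrightarrow> ndist E y v < s \<Longrightarrow> ereal (\<phi> y - (b - (a - \<phi> y))) < ext E \<phi> v"
      using LSC_lower_bound[OF ext_LSC[OF \<phi>]] y by blast
    have "v \<notin> {u \<in> K. f u \<le> ereal (a - \<phi> u)}" if v: "v \<in> metric.mball y (min r s)" for v
    proof -
      have "ereal b < f v" using r(2)[of v] v by simp
      moreover have "a - \<phi> v < b" using s(2)[of v] v by (simp add: ext_def)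
      ultimately have "ereal (a - \<phi> v) < f v" by (meson less_ereal.simps(1) less_trans)
      then show ?thesis by auto
    qed
    then show ?thesis using r(1) s(1) by (intro exI[of _ "min r s"]) (auto simp: disjnt_iff)
  qed
qed

lemma slope_lower_bound:
  assumes "slope E S x < ereal s" "S x \<noteq> -\<infinity>"
  obtains r where "r > 0" "\<And>y. y \<in> carrier E \<Longrightarrow> ndist E x y < r \<Longrightarrow> S x \<le> S y + ereal (s * ndist E x y)"
proof -
  have x: "x \<in> carrier E" "S x < \<infinity>" using assms(1) by (auto simp: slope_def split: if_splits)
  then obtain sx where sx: "S x = ereal sx" using assms(2) by (cases "S x") auto
  have "Limsup (atin metric.mtopology x) (\<lambda>y. max 0 (S x - S y) / ereal (ndist E x y)) < ereal s"
    using assms(1) x by (simp add: slope_def)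
  from Limsup_lessD[OF this] x(1)
  have "\<exists>r>0. \<forall>y. y \<in> carrier E \<and> 0 < ndist E y x \<and> ndist E y x < r \<longrightarrow>
      max 0 (S x - S y) / ereal (ndist E x y) < ereal s"
    unfolding metric.eventually_atin_metric by simp
  then obtain r where r: "r > 0" "\<And>y. y \<in> carrier E \<Longrightarrow> 0 < ndist E y x \<Longrightarrow> ndist E y x < r \<Longrightarrow>
      max 0 (S x - S y) / ereal (ndist E x y) < ereal s"
    by blast
  have "S x \<le> S y + ereal (s * ndist E x y)" if y: "y \<in> carrier E" "ndist E x y < r" for y
  proof (cases "y = x")
    case False
    then have d: "0 < ndist E x y" using x y by auto
    then have q: "max 0 (S x - S y) / ereal (ndist E x y) < ereal s"
      using r(2)[OF y(1)] y(2) by (simp add: metric.commute)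
    show ?thesis
    proof (cases "S y")
      case (real sy)
      with q sx d have "max 0 (sx - sy) / ndist E x y < s"
        by (simp add: max_def split: if_splits)
      then have "max 0 (sx - sy) < s * ndist E x y" using d by (simp add: pos_divide_less_eq)
      then show ?thesis using sx real by simp
    next
      case MInf
      with q sx d show ?thesis by (simp add: max_def)
    qed simp
  qed (use x sx in simp)
  then show ?thesis using that r(1) by blast
qed

lemma slope_nonneg: "0 \<le> slope E S x"
  by (simp add: slope_def)

text \<open>
  A Frechet subgradient bounds the descent of \<open>S - l\<close> by \<open>o(\<parallel>y - x\<parallel>)\<close>.
\<close>

lemma slope_frechet:
  assumes l: "l \<in> frechet_subdiff E S x" and S: "\<And>y. S y \<noteq> -\<infinity>"
  shows "slope E (\<lambda>y. S y + ext E (\<lambda>v. - l v) y) x = 0"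
proof -
  have x: "x \<in> carrier E" "S x < \<infinity>" and ld: "l \<in> dual E"
    and lim: "0 \<le> Liminf (atin metric.mtopology x)
        (\<lambda>y. (S y - S x - ereal (l (y \<ominus> x))) / ereal (ndist E y x))"
    using l by (auto simp: frechet_subdiff_def)
  obtain sx where sx: "S x = ereal sx" using x(2) S[of x] by (cases "S x") auto
  let ?g = "\<lambda>y. S y + ext E (\<lambda>v. - l v) y"
  have "Limsup (atin metric.mtopology x) (\<lambda>y. max 0 (?g x - ?g y) / ereal (ndist E x y)) \<le> 0"
    unfolding Limsup_le_iff
  proof (intro allI impI)
    fix c :: ereal assume "0 < c"
    then obtain e where e: "0 < e" "ereal e < c" using ereal_dense2[of 0 c] by auto
    then have "ereal (-e) < 0" by simp
    then have "\<forall>\<^sub>F y in atin metric.mtopology x. ereal (-e) < (S y - S x - ereal (l (y \<ominus> x))) / ereal (ndist E y x)"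
      using lim unfolding le_Liminf_iff by blast
    then obtain r where r: "r > 0" "\<And>y. y \<in> carrier E \<Longrightarrow> 0 < ndist E y x \<Longrightarrow> ndist E y x < r \<Longrightarrow>
        ereal (-e) < (S y - S x - ereal (l (y \<ominus> x))) / ereal (ndist E y x)"
      using x(1) unfolding metric.eventually_atin_metric by blast
    have "max 0 (?g x - ?g y) / ereal (ndist E x y) < c"
      if y: "y \<in> carrier E" "0 < ndist E y x" "ndist E y x < r" for y
    proof (cases "S y")
      case (real sy)
      have "- e < (sy - sx - (l y - l x)) / ndist E y x"
        using r(2)[OF y] real sx y x by (simp add: dual_diff[OF ld])
      then have "- e * ndist E y x < sy - sx - (l y - l x)" using y by (simp add: pos_less_divide_eq)
      moreover have "0 < e * ndist E y x" using e y by simp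
      ultimately have "max 0 ((sx - l x) - (sy - l y)) / ndist E y x < e"
        using y by (simp add: pos_divide_less_eq)
      then have "ereal (max 0 ((sx - l x) - (sy - l y)) / ndist E y x) < c"
        using e(2) by (meson less_ereal.simps(1) less_trans)
      moreover have "max 0 (?g x - ?g y) / ereal (ndist E x y)
          = ereal (max 0 ((sx - l x) - (sy - l y)) / ndist E y x)"
        using real sx x y metric.commute[of x y] by (auto simp: ext_def max_def)
      ultimately show ?thesis by simp
    next
      case PInf
      then show ?thesis using sx x y \<open>0 < c\<close> by (simp add: ext_def max_def)
    qed (use S in auto)
    then show "\<forall>\<^sub>F y in atin metric.mtopology x. max 0 (?g x - ?g y) / ereal (ndist E x y) < c"
      unfolding metric.eventually_atin_metric using r(1) by blast
  qed
  then show ?thesis using x by (simp add: slope_def ext_def max_def)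
qed

text \<open>
  The bound has to be uniform in \<open>t\<close>, while the bound \<open>\<delta>\<close> on the diameter that decouplability
  provides depends on the radius. Only finitely many radii of mesh \<open>h\<close> are used, by induction on
  their number: rounding \<open>t\<close> up to the next radius costs at most \<open>\<tau> * h\<close>.
\<close>

lemma decouplable_lower_bound:
  assumes dec: "decouplable E k f x" and x: "x \<in> carrier E"
    and sx: "(\<Sum>i=1..k. f i x) = ereal s" and \<tau>: "0 \<le> \<tau>" and r: "0 < r"
    and bound: "\<And>y. y \<in> carrier E \<Longrightarrow> ndist E x y < r \<Longrightarrow>
                  ereal s \<le> (\<Sum>i=1..k. f i y) + ereal (\<tau> * ndist E x y)"
  obtains R where "R > 0"
    "\<And>e. 0 < e \<Longrightarrow> \<exists>\<delta>>0. \<forall>t\<in>{0..R}. \<forall>y. (\<forall>i\<in>{1..k}. y i \<in> ncball E x t) \<and>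
        (\<forall>i\<in>{1..k}. \<forall>j\<in>{1..k}. ndist E (y i) (y j) \<le> \<delta>) \<longrightarrow>
        ereal s \<le> (\<Sum>i=1..k. f i (y i)) + ereal (\<tau> * t + e)"
proof -
  define near where "near t \<delta> y \<longleftrightarrow> (\<forall>i\<in>{1..k}. y i \<in> ncball E x t) \<and>
      (\<forall>i\<in>{1..k}. \<forall>j\<in>{1..k}. ndist E (y i) (y j) \<le> \<delta>)" for t \<delta> y
  have near_mono: "near t' \<delta>' y" if "near t \<delta> y" "t \<le> t'" "\<delta> \<le> \<delta>'" for t t' \<delta> \<delta>' y
    using that unfolding near_def by (auto intro: order_trans)
  obtain \<Lambda> where \<Lambda>: "\<Lambda> > 0" and dec': "\<forall>\<rho>\<in>{0..<\<Lambda>}.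
      (SUP \<delta>\<in>{0<..}. INF y\<in>ncball E x (\<rho> + \<delta>). \<Sum>i=1..k. f i y)
      \<le> (SUP \<delta>\<in>{0<..}. Inf {\<Sum>i=1..k. f i (y i) | y. near \<rho> \<delta> y})"
    using dec unfolding decouplable_def near_def by blast
  define R where "R = min (\<Lambda> / 2) (r / 2)"
  have R: "R > 0" "R < \<Lambda>" "R \<le> r / 2" using \<Lambda> r by (auto simp: R_def)
  have single: "\<exists>\<delta>>0. \<forall>y. near \<rho> \<delta> y \<longrightarrow> ereal s \<le> (\<Sum>i=1..k. f i (y i)) + ereal (\<tau> * \<rho> + e)"
    if \<rho>: "0 \<le> \<rho>" "\<rho> \<le> R" and e: "0 < e" for \<rho> e
  proof -
    define q where "q = min (r / 4) (e / 2 / (\<tau> + 1))"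
    have q: "0 < q" "q \<le> r / 4" "q \<le> e / 2 / (\<tau> + 1)"
      unfolding q_def by (rule min.cobounded1 min.cobounded2 | use r e \<tau> in simp)+
    have "\<tau> * q \<le> (\<tau> + 1) * (e / 2 / (\<tau> + 1))" using \<tau> q by (intro mult_mono) auto
    also have "\<dots> = e / 2" using \<tau> by (subst times_divide_eq_right, subst nonzero_mult_div_cancel_left) auto
    also have "\<dots> < e" using e by simp
    finally have qe: "\<tau> * q < e" .
    have "ereal (s - \<tau> * \<rho> - e) < ereal (s - \<tau> * (\<rho> + q))" using qe by (simp add: algebra_simps)
    also have "\<dots> \<le> (INF y\<in>ncball E x (\<rho> + q). \<Sum>i=1..k. f i y)"
    proof (rule INF_greatest)
      fix y assume y: "y \<in> ncball E x (\<rho> + q)"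
      then have "ereal s \<le> (\<Sum>i=1..k. f i y) + ereal (\<tau> * ndist E x y)"
        using \<rho> q(1,2) R r by (intro bound) auto
      moreover have "\<tau> * ndist E x y \<le> \<tau> * (\<rho> + q)" using y \<tau> by (intro mult_left_mono) auto
      ultimately show "ereal (s - \<tau> * (\<rho> + q)) \<le> (\<Sum>i=1..k. f i y)"
        by (cases "\<Sum>i=1..k. f i y") auto
    qed
    also have "\<dots> \<le> (SUP \<delta>\<in>{0<..}. INF y\<in>ncball E x (\<rho> + \<delta>). \<Sum>i=1..k. f i y)"
      using q(1) by (intro SUP_upper) simp
    also have "\<dots> \<le> (SUP \<delta>\<in>{0<..}. Inf {\<Sum>i=1..k. f i (y i) | y. near \<rho> \<delta> y})"
      using \<rho> R by (intro dec'[rule_format]) simp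
    finally obtain \<delta> where \<delta>: "\<delta> > 0"
      "ereal (s - \<tau> * \<rho> - e) < Inf {\<Sum>i=1..k. f i (y i) | y. near \<rho> \<delta> y}"
      unfolding less_SUP_iff by blast
    have "ereal s \<le> (\<Sum>i=1..k. f i (y i)) + ereal (\<tau> * \<rho> + e)" if y: "near \<rho> \<delta> y" for y
    proof -
      have "(\<Sum>i=1..k. f i (y i)) \<in> {\<Sum>i=1..k. f i (y i) | y. near \<rho> \<delta> y}" using y by blast
      from less_le_trans[OF \<delta>(2) Inf_lower[OF this]] show ?thesis
        by (cases "\<Sum>i=1..k. f i (y i)") auto
    qed
    then show ?thesis using \<delta>(1) by blast
  qed
  have "\<exists>\<delta>>0. \<forall>t\<in>{0..R}. \<forall>y. near t \<delta> y \<longrightarrow> ereal s \<le> (\<Sum>i=1..k. f i (y i)) + ereal (\<tau> * t + e)"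
    if e: "0 < e" for e
  proof -
    obtain n where n: "real n > 2 * \<tau> * R / e" using reals_Archimedean2 by blast
    define h where "h = R / real (Suc n)"
    have h: "0 < h" "real (Suc n) * h = R" using R by (auto simp: h_def)
    have "2 * \<tau> * R / e < real (Suc n)" using n by simp
    then have he: "\<tau> * h \<le> e / 2" using e by (simp add: h_def field_simps)
    have "\<exists>\<delta>>0. \<forall>t\<in>{0..real j * h}. \<forall>y. near t \<delta> y \<longrightarrow>
        ereal s \<le> (\<Sum>i=1..k. f i (y i)) + ereal (\<tau> * t + e)" if "real j * h \<le> R" for j
      using that
    proof (induction j)
      case 0
      show ?case using single[of 0 e] R(1) e by simp
    next
      case (Suc j)
      have "real j * h \<le> real (Suc j) * h" using h by simp
      with Suc obtain \<delta>1 where \<delta>1: "\<delta>1 > 0" "\<forall>t\<in>{0..real j * h}. \<forall>y. near t \<delta>1 y \<longrightarrow>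
          ereal s \<le> (\<Sum>i=1..k. f i (y i)) + ereal (\<tau> * t + e)"
        by fastforce
      have "0 \<le> real (Suc j) * h" "0 < e / 2" using h e by auto
      from single[OF this(1) Suc.prems this(2)] obtain \<delta>2 where \<delta>2: "\<delta>2 > 0"
          "\<forall>y. near (real (Suc j) * h) \<delta>2 y \<longrightarrow>
            ereal s \<le> (\<Sum>i=1..k. f i (y i)) + ereal (\<tau> * (real (Suc j) * h) + e / 2)"
        by blast
      have "ereal s \<le> (\<Sum>i=1..k. f i (y i)) + ereal (\<tau> * t + e)"
        if t: "t \<in> {0..real (Suc j) * h}" and y: "near t (min \<delta>1 \<delta>2) y" for t y
      proof (cases "t \<le> real j * h")
        case True
        moreover have "near t \<delta>1 y" using y by (rule near_mono) auto
        ultimately show ?thesis using t \<delta>1(2) by simp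
      next
        case False
        have "near (real (Suc j) * h) \<delta>2 y" using y by (rule near_mono) (use t in auto)
        with \<delta>2(2) have "ereal s \<le> (\<Sum>i=1..k. f i (y i)) + ereal (\<tau> * (real (Suc j) * h) + e / 2)"
          by blast
        moreover have "\<tau> * (real (Suc j) * h) \<le> \<tau> * (t + h)"
          using False \<tau> by (intro mult_left_mono) (auto simp: algebra_simps)
        then have "\<tau> * (real (Suc j) * h) + e / 2 \<le> \<tau> * t + e" using he by (simp add: algebra_simps)
        ultimately show ?thesis by (meson add_left_mono ereal_less_eq(3) order_trans)
      qed
      then show ?case using \<delta>1(1) \<delta>2(1) by (intro exI[of _ "min \<delta>1 \<delta>2"]) simp
    qed
    from this[of "Suc n"] show ?thesis unfolding h(2) by simp
  qed
  then show ?thesis using that[OF R(1)] unfolding near_def by presburger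
qed

end

section \<open>The fuzzy sum rules\<close>

lemma sum_not_MInf:
  fixes f :: "'i \<Rightarrow> ereal"
  assumes "\<And>i. i \<in> I \<Longrightarrow> f i \<noteq> -\<infinity>"
  shows "sum f I \<noteq> -\<infinity>"
  using assms by (induction I rule: infinite_finite_induct) auto

context banach_powers
begin

text \<open>
  One application of Ekeland's principle and of the fuzzy minimization rule, with the errors
  recorded explicitly in terms of a tolerance \<open>\<eta>\<close>. The summands are controlled individually because
  each is almost bounded below by its value at \<open>x\<close>: an upper bound for the sum then leaves at most
  \<open>k * \<eta>\<close> for each of them.
\<close>

lemma approximate_sum_rule:
  assumes D: "subdifferential D" and k: "1 \<le> k" and R1: "fuzzy_min_rule D (pow_space E k)"
    and f: "\<And>i. i \<in> {1..k} \<Longrightarrow> f i \<in> LSC E" and x: "x \<in> carrier E"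
    and fx: "\<And>i. i \<in> {1..k} \<Longrightarrow> f i x = ereal (a i)"
    and \<tau>: "0 \<le> \<tau>" and r: "0 < r"
    and bound: "\<And>y. y \<in> carrier E \<Longrightarrow> ndist E x y < r \<Longrightarrow>
        (\<Sum>i=1..k. f i x) \<le> (\<Sum>i=1..k. f i y) + ereal (\<tau> * ndist E x y)"
    and dec: "decouplable E k f x" and \<eta>: "0 < \<eta>"
  shows "\<exists>y m. (\<forall>i\<in>{1..k}. (y i, m i) \<in> subdiff_graph D E (f i) \<and> m i \<in> dual E \<and> ndist E (y i) x \<le> \<eta> \<and>
      ereal (a i - \<eta>) \<le> f i (y i) \<and> f i (y i) \<le> ereal (a i + real k * \<eta>) \<and>
      ndiam E k y * dual_norm E (m i) \<le> \<eta> * (2 * \<tau> + 4 * \<eta> + 2 * real k + 2)) \<and>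
      dual_norm E (\<lambda>v. \<Sum>i=1..k. m i v) \<le> \<tau> + 2 * \<eta>"
proof -
  let ?P = "pow_space E k"
  interpret P: banach_space ?P by (rule banach_pow)
  define c where "c = diag k x"
  define F where "F = pow_sum f k"
  define s where "s = (\<Sum>i=1..k. a i)"
  have cP: "c \<in> carrier ?P" unfolding c_def by (rule diag_carrier[OF k x])
  have F_eq: "F u = (\<Sum>i=1..k. f i (coord k i u))" if "u \<in> carrier ?P" for u
    unfolding F_def by (rule pow_sum_eq[OF k that])
  have FL: "F \<in> LSC ?P" unfolding F_def by (rule pow_sum_LSC[OF k f])
  have F_MInf: "F u \<noteq> -\<infinity>" for u using FL unfolding P.LSC_iff by blast
  have sx: "(\<Sum>i=1..k. f i x) = ereal s"
  proof -
    have "(\<Sum>i=1..k. f i x) = (\<Sum>i=1..k. ereal (a i))" by (rule sum.cong) (use fx in auto)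
    then show ?thesis by (simp add: s_def)
  qed
  have Fc: "F c = ereal s"
    unfolding F_eq[OF cP] sx[symmetric] by (rule sum.cong) (auto simp: c_def coord_tup[OF k])
  \<comment> \<open>Decouplability and lower semicontinuity bound \<open>F\<close> below on a ball of radius \<open>\<rho>\<close>.\<close>
  obtain R where R: "R > 0" and near_diag: "\<And>e. 0 < e \<Longrightarrow> \<exists>\<delta>>0. \<forall>t\<in>{0..R}. \<forall>y. (\<forall>i\<in>{1..k}. y i \<in> ncball E x t) \<and>
        (\<forall>i\<in>{1..k}. \<forall>j\<in>{1..k}. ndist E (y i) (y j) \<le> \<delta>) \<longrightarrow>
        ereal s \<le> (\<Sum>i=1..k. f i (y i)) + ereal (\<tau> * t + e)"
    by (rule decouplable_lower_bound[OF dec x sx \<tau> r bound[unfolded sx]]; (assumption | rule that))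
  have "\<forall>i\<in>{1..k}. \<exists>q>0. \<forall>y\<in>carrier E. ndist E x y < q \<longrightarrow> ereal (a i - \<eta>) < f i y"
  proof
    fix i assume i: "i \<in> {1..k}"
    then have "ereal (a i - \<eta>) < f i x" using fx \<eta> by simp
    then show "\<exists>q>0. \<forall>y\<in>carrier E. ndist E x y < q \<longrightarrow> ereal (a i - \<eta>) < f i y"
      using f[OF i, unfolded LSC_iff] x by blast
  qed
  from bchoice[OF this] obtain q where q: "\<And>i. i \<in> {1..k} \<Longrightarrow> q i > 0"
    "\<And>i y. i \<in> {1..k} \<Longrightarrow> y \<in> carrier E \<Longrightarrow> ndist E x y < q i \<Longrightarrow> ereal (a i - \<eta>) < f i y"
    by blast
  define q0 where "q0 = Min (q ` {1..k})"
  have q0: "q0 > 0" "\<And>i. i \<in> {1..k} \<Longrightarrow> q0 \<le> q i"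
    unfolding q0_def using q(1) k by (auto simp: Min_gr_iff)
  define \<rho> where "\<rho> = min R (min \<eta> (q0 / 2))"
  have \<rho>: "0 < \<rho>" "\<rho> \<le> R" "\<rho> \<le> \<eta>" "\<rho> < q0" using R \<eta> q0 by (auto simp: \<rho>_def min_def)
  have coord_near: "coord k i u \<in> carrier E" "ndist E x (coord k i u) \<le> ndist ?P c u"
    if "u \<in> carrier ?P" "i \<in> {1..k}" for u i
    using coord_carrier[OF k that] ndist_coord_le[OF k cP that]
    by (simp_all add: c_def coord_tup[OF k that(2)])
  have f_low: "ereal (a i - \<eta>) < f i (coord k i u)"
    if "u \<in> carrier ?P" "ndist ?P c u \<le> \<rho>" "i \<in> {1..k}" for u i
    using coord_near[OF that(1,3)] that \<rho> q0(2)[OF that(3)] by (intro q(2)) auto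
  have F_low: "ereal (s - real k * \<eta>) \<le> F u" if u: "u \<in> carrier ?P" "ndist ?P c u \<le> \<rho>" for u
  proof -
    have "ereal (s - real k * \<eta>) = (\<Sum>i=1..k. ereal (a i - \<eta>))" by (simp add: s_def sum_subtractf)
    also have "\<dots> \<le> F u" unfolding F_eq[OF u(1)] by (intro sum_mono less_imp_le f_low u)
    finally show ?thesis .
  qed
  \<comment> \<open>Ekeland's point is within \<open>e / \<eta> = \<rho> / 2\<close> of the centre, hence interior to the ball. The weight
    \<open>N\<close> compensates the loss \<open>k * \<eta>\<close> on tuples of diameter at least \<open>\<delta>\<close>.\<close>
  define e where "e = \<eta> * \<rho> / 2"
  have e: "0 < e" using \<eta> \<rho> by (simp add: e_def)
  obtain \<delta> where \<delta>: "\<delta> > 0" "\<forall>t\<in>{0..R}. \<forall>y. (\<forall>i\<in>{1..k}. y i \<in> ncball E x t) \<and>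
        (\<forall>i\<in>{1..k}. \<forall>j\<in>{1..k}. ndist E (y i) (y j) \<le> \<delta>) \<longrightarrow>
        ereal s \<le> (\<Sum>i=1..k. f i (y i)) + ereal (\<tau> * t + e)"
    using near_diag[OF e] by blast
  define N where "N = real k * \<eta> / \<delta>"
  have N: "0 \<le> N" "N * \<delta> = real k * \<eta>" using \<delta>(1) \<eta> by (simp_all add: N_def)
  define A where "A = {u \<in> P.metric.mcball c \<rho>. F u < \<infinity>}"
  define g where "g u = real_of_ereal (F u)" for u
  define G where "G u = g u + penalty k \<tau> N 0 c c u" for u
  have A: "u \<in> carrier ?P" "ndist ?P c u \<le> \<rho>" "F u = ereal (g u)" if "u \<in> A" for u
    using that F_MInf[of u] by (auto simp: A_def g_def ereal_real)
  have pen_nonneg: "0 \<le> \<tau> * ndist ?P c u" "0 \<le> N * pdiam k u" for u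
    using \<tau> N pdiam_nonneg[OF k] by auto
  have G_eq: "G u = g u + \<tau> * ndist ?P c u + N * pdiam k u" for u
    by (simp add: G_def penalty_def[OF k])
  have g_low: "s - real k * \<eta> \<le> g u" if "u \<in> A" for u
    using F_low[OF A(1,2)[OF that]] A(3)[OF that] by simp
  have G_low: "s - e \<le> G u" if u: "u \<in> A" for u
  proof (cases "pdiam k u \<le> \<delta>")
    case True
    have C: "\<forall>i\<in>{1..k}. coord k i u \<in> ncball E x (ndist ?P c u)"
      using coord_near[OF A(1)[OF u]] x by simp
    have T: "ndist ?P c u \<in> {0..R}" using A(2)[OF u] \<rho> by simp
    have "ereal s \<le> F u + ereal (\<tau> * ndist ?P c u + e)"
      unfolding F_eq[OF A(1)[OF u]]
      by (rule \<delta>(2)[THEN bspec, OF T, THEN spec[of _ "\<lambda>i. coord k i u"], THEN mp,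
            OF conjI[OF C True[unfolded ndiam_le_iff[OF k]]]])
    then show ?thesis using A(3)[OF u] pen_nonneg(2)[of u] by (simp add: G_eq)
  next
    case False
    then have "N * \<delta> \<le> N * pdiam k u" using N by (intro mult_left_mono) auto
    then show ?thesis using N g_low[OF u] pen_nonneg(1)[of u] e by (simp add: G_eq)
  qed
  have closed: "closedin P.metric.mtopology {u \<in> A. G u \<le> b}" for b
  proof -
    have eq: "{u \<in> A. G u \<le> b} = {u \<in> P.metric.mcball c \<rho>. F u \<le> ereal (b - penalty k \<tau> N 0 c c u)}"
    proof (intro equalityI subsetI)
      fix u assume "u \<in> {u \<in> A. G u \<le> b}"
      then have "u \<in> A" "G u \<le> b" by auto
      then show "u \<in> {u \<in> P.metric.mcball c \<rho>. F u \<le> ereal (b - penalty k \<tau> N 0 c c u)}"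
        using A(3)[of u] by (auto simp: G_def A_def)
    next
      fix u assume "u \<in> {u \<in> P.metric.mcball c \<rho>. F u \<le> ereal (b - penalty k \<tau> N 0 c c u)}"
      then have u: "u \<in> P.metric.mcball c \<rho>" "F u \<le> ereal (b - penalty k \<tau> N 0 c c u)" by auto
      then have "F u < \<infinity>" by (auto intro: le_less_trans)
      then have uA: "u \<in> A" using u(1) by (simp add: A_def)
      then show "u \<in> {u \<in> A. G u \<le> b}" using u(2) A(3)[OF uA] by (simp add: G_def)
    qed
    show ?thesis unfolding eq
      by (rule P.closedin_sublevel[OF FL penalty_nlipschitz[OF k \<tau> N(1) order_refl cP cP]]) blast
  qed
  have cA: "c \<in> A" using cP \<rho> Fc by (simp add: A_def)
  have Gc: "G c = s" using Fc cP pdiam_diag[OF k x] by (simp add: G_eq g_def c_def)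
  obtain z where z: "z \<in> A" "G z + \<eta> * ndist ?P c z \<le> s"
    "\<And>u. u \<in> A \<Longrightarrow> G z \<le> G u + \<eta> * ndist ?P z u"
    using P.metric.ekeland[OF P.complete closed G_low cA \<eta>] unfolding Gc by blast
  note zP = A(1)[OF z(1)]
  have "\<eta> * ndist ?P c z \<le> \<eta> * (\<rho> / 2)" using z(2) G_low[OF z(1)] by (simp add: e_def)
  then have cz: "ndist ?P c z \<le> \<rho> / 2" using \<eta> by simp
  have "0 \<le> \<eta> * ndist ?P c z" using \<eta> by simp
  then have Gz: "G z \<le> s" using z(2) by linarith
  have diam_z: "N * pdiam k z \<le> real k * \<eta>" and gz: "g z \<le> s"
    using Gz g_low[OF z(1)] pen_nonneg[of z] by (simp_all add: G_eq)
  define \<phi> where "\<phi> = penalty k \<tau> N \<eta> c z"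
  note pen = k \<tau> N(1) less_imp_le[OF \<eta>] cP zP
  have \<phi>_eq: "\<phi> u = penalty k \<tau> N 0 c c u + \<eta> * ndist ?P z u" for u
    by (simp add: \<phi>_def penalty_def[OF k])
  have locmin: "F z + ext ?P \<phi> z \<le> F y + ext ?P \<phi> y" if y: "y \<in> P.metric.mball z (\<rho> / 2)" for y
  proof (cases "F y = \<infinity>")
    case True
    then show ?thesis by (simp add: ext_def)
  next
    case False
    from y have yP: "y \<in> carrier ?P" and zy: "ndist ?P z y < \<rho> / 2" by auto
    have "ndist ?P c y \<le> ndist ?P c z + ndist ?P z y" using cP zP yP by (rule P.metric.triangle)
    then have yA: "y \<in> A" using False cz zy yP cP by (simp add: A_def less_top[symmetric] top_ereal_def)
    show ?thesis
      using z(3)[OF yA] A(3)[OF yA] A(3)[OF z(1)] yP zP by (simp add: ext_def \<phi>_eq G_def)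
  qed
  have "F z < \<infinity>" using z(1) by (simp add: A_def)
  moreover have "0 < \<rho> / 2" using \<rho> by simp
  ultimately obtain p p' w w' where
      pG: "\<And>n. (p n, p' n) \<in> subdiff_graph D ?P F" and wG: "\<And>n. (w n, w' n) \<in> subdiff_graph D ?P (ext ?P \<phi>)"
      and plim: "limitin P.metric.mtopology p z sequentially"
      and Flim: "(\<lambda>n. F (p n)) \<longlonglongrightarrow> F z"
      and nlim: "(\<lambda>n. dual_norm ?P (\<lambda>v. p' n v + w' n v)) \<longlonglongrightarrow> 0"
    using R1[unfolded fuzzy_min_rule_def, rule_format, of F \<phi> z] FL
      penalty_convex[OF pen] penalty_nlipschitz[OF pen] zP locmin
    unfolding \<phi>_def[symmetric] by blast
  define \<mu> where "\<mu> = min (\<rho> / 2) (\<eta> / (2 * N + 1))"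
  have \<mu>: "0 < \<mu>" "\<mu> \<le> \<rho> / 2" "\<mu> \<le> \<eta> / (2 * N + 1)"
    unfolding \<mu>_def by (rule min.cobounded1 min.cobounded2 | use \<rho>(1) \<eta> N(1) in simp)+
  have "2 * N * \<mu> \<le> (2 * N + 1) * (\<eta> / (2 * N + 1))"
    using N(1) \<eta> \<mu> by (intro mult_mono) auto
  also have "\<dots> = \<eta>" using N(1) by (subst times_divide_eq_right, subst nonzero_mult_div_cancel_left) auto
  finally have N\<mu>: "2 * N * \<mu> \<le> \<eta>" .
  have "\<forall>\<^sub>F n in sequentially. ndist ?P (p n) z < \<mu>"
    using plim \<mu>(1) unfolding P.metric.limitin_metric by (auto elim: eventually_mono)
  moreover have "F z < ereal (s + \<eta>)" using A(3)[OF z(1)] gz \<eta> by simp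
  then have "\<forall>\<^sub>F n in sequentially. F (p n) < ereal (s + \<eta>)"
    by (rule order_tendstoD(2)[OF Flim])
  moreover have "\<forall>\<^sub>F n in sequentially. dual_norm ?P (\<lambda>v. p' n v + w' n v) < \<eta>"
    by (rule order_tendstoD(2)[OF nlim \<eta>])
  ultimately have "\<forall>\<^sub>F n in sequentially. ndist ?P (p n) z < \<mu> \<and> F (p n) < ereal (s + \<eta>) \<and>
      dual_norm ?P (\<lambda>v. p' n v + w' n v) < \<eta>"
    by eventually_elim simp
  then obtain n where n: "ndist ?P (p n) z < \<mu>" "F (p n) < ereal (s + \<eta>)"
      "dual_norm ?P (\<lambda>v. p' n v + w' n v) < \<eta>"
    unfolding eventually_sequentially by blast
  define u where "u = p n"
  have u: "u \<in> carrier ?P" and l: "p' n \<in> D ?P F u" using pG[of n] by (auto simp: subdiff_graph_def u_def)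
  have wn: "w n \<in> carrier ?P" and g': "w' n \<in> D ?P (ext ?P \<phi>) (w n)"
    using wG[of n] by (auto simp: subdiff_graph_def)
  have l_dual: "p' n \<in> dual ?P" using subdifferential_subset_dual[OF D banach_pow FL u] l by (rule subsetD)
  obtain m where m: "\<And>i. i \<in> {1..k} \<Longrightarrow> m i \<in> D E (f i) (coord k i u)"
      and lm: "\<And>v. v \<in> carrier ?P \<Longrightarrow> p' n v = (\<Sum>i=1..k. m i (coord k i v))"
    using subdiff_pow_sum[OF D k f u l[unfolded F_def]] by blast
  have m_dual: "m i \<in> dual E" if i: "i \<in> {1..k}" for i
    using subdifferential_subset_dual[OF D banach_space_axioms f[OF i] coord_near(1)[OF u i]] m[OF i] by (rule subsetD)
  note sub = penalty_subgradient[OF pen D wn g'[unfolded \<phi>_def]]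
  have nn: "0 \<le> \<tau> + 2 * N + \<eta>" "0 \<le> \<tau> + \<eta>" using \<tau> N \<eta> by auto
  note comp = components_bound[OF k l_dual m_dual lm sub(1) less_imp_le[OF n(3)] sub(2) nn(1) sub(3) nn(2) less_imp_le[OF \<eta>]]
  have cu: "ndist ?P c u \<le> \<rho>"
    using P.metric.triangle[OF cP zP u] cz n(1) \<mu>(2) P.metric.commute[of z u] by (simp add: u_def)
  have diam_u: "pdiam k u \<le> 2 * \<eta>"
    using pdiam_lipschitz[OF k u cP] pdiam_diag[OF k x] cu \<rho> P.metric.commute[of u c] by (simp add: c_def)
  have "N * pdiam k u \<le> N * (pdiam k z + 2 * \<mu>)"
    using pdiam_lipschitz[OF k u zP] n(1) N by (intro mult_left_mono) (auto simp: u_def)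
  then have diam_uN: "N * pdiam k u \<le> real k * \<eta> + \<eta>" using diam_z N\<mu> by (simp add: algebra_simps)
  have diam_bound: "pdiam k u * dual_norm E (m i) \<le> \<eta> * (2 * \<tau> + 4 * \<eta> + 2 * real k + 2)"
    if i: "i \<in> {1..k}" for i
  proof -
    have "pdiam k u * dual_norm E (m i) \<le> pdiam k u * (\<tau> + 2 * N + \<eta> + \<eta>)"
      by (intro mult_left_mono comp(1) i pdiam_nonneg[OF k])
    also have "\<dots> = pdiam k u * (\<tau> + 2 * \<eta>) + 2 * (N * pdiam k u)" by (simp add: algebra_simps)
    also have "\<dots> \<le> (2 * \<eta>) * (\<tau> + 2 * \<eta>) + 2 * (real k * \<eta> + \<eta>)"
      using diam_u diam_uN \<tau> \<eta> by (intro add_mono mult_right_mono mult_left_mono) auto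
    also have "\<dots> = \<eta> * (2 * \<tau> + 4 * \<eta> + 2 * real k + 2)" by (simp add: algebra_simps)
    finally show ?thesis .
  qed
  have f_up: "f i (coord k i u) \<le> ereal (a i + real k * \<eta>)" if i: "i \<in> {1..k}" for i
  proof -
    have "ereal (s - a i - (real k - 1) * \<eta>) = (\<Sum>j\<in>{1..k} - {i}. ereal (a j - \<eta>))"
      using i by (simp add: s_def sum_subtractf sum_diff1 of_nat_diff)
    also have "\<dots> \<le> (\<Sum>j\<in>{1..k} - {i}. f j (coord k j u))"
      by (intro sum_mono less_imp_le f_low u cu) auto
    finally have "f i (coord k i u) + ereal (s - a i - (real k - 1) * \<eta>) \<le> F u"
      unfolding F_eq[OF u] using i by (simp add: sum.remove[of _ i] add_left_mono)
    also have "\<dots> < ereal (s + \<eta>)" using n(2) by (simp add: u_def)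
    finally show ?thesis by (cases "f i (coord k i u)") (auto simp: algebra_simps)
  qed
  have "(coord k i u, m i) \<in> subdiff_graph D E (f i) \<and> m i \<in> dual E \<and> ndist E (coord k i u) x \<le> \<eta> \<and>
      ereal (a i - \<eta>) \<le> f i (coord k i u) \<and> f i (coord k i u) \<le> ereal (a i + real k * \<eta>) \<and>
      pdiam k u * dual_norm E (m i) \<le> \<eta> * (2 * \<tau> + 4 * \<eta> + 2 * real k + 2)"
    if i: "i \<in> {1..k}" for i
    using m[OF i] m_dual[OF i] coord_near[OF u i] cu \<rho>(3) metric.commute[of x "coord k i u"]
      f_low[OF u cu i] f_up[OF i] diam_bound[OF i] by (auto simp: subdiff_graph_def)
  moreover have "dual_norm E (\<lambda>v. \<Sum>i=1..k. m i v) \<le> \<tau> + 2 * \<eta>" using comp(2) by simp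
  ultimately show ?thesis by (intro exI[of _ "\<lambda>i. coord k i u"] exI[of _ m]) simp
qed

text \<open>
  The slope \<open>s\<close> itself need not bound the descent near \<open>x\<close>, so \<open>s + \<eta> n\<close> is used for \<open>\<tau>\<close>, with
  tolerances \<open>\<eta> n\<close> tending to 0.
\<close>

theorem slope_sum_rule:
  assumes D: "subdifferential D" and k: "1 \<le> k" and R1: "fuzzy_min_rule D (pow_space E k)"
    and f: "\<And>i. i \<in> {1..k} \<Longrightarrow> f i \<in> LSC E" and x: "x \<in> carrier E"
    and dec: "decouplable E k f x" and fin: "slope E (\<lambda>v. \<Sum>i=1..k. f i v) x < \<infinity>"
  shows "\<exists>(y :: nat \<Rightarrow> nat \<Rightarrow> 'a uni) (m :: nat \<Rightarrow> nat \<Rightarrow> 'a uni \<Rightarrow> real).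
          (\<forall>i\<in>{1..k}.
             (\<forall>n. (y i n, m i n) \<in> subdiff_graph D E (f i)) \<and>
             limitin (ntop E) (y i) x sequentially \<and>
             (\<lambda>n. f i (y i n)) \<longlonglongrightarrow> f i x \<and>
             (\<lambda>n. ndiam E k (\<lambda>j. y j n) * dual_norm E (m i n)) \<longlonglongrightarrow> 0) \<and>
          limsup (\<lambda>n. ereal (dual_norm E (\<lambda>v. \<Sum>i=1..k. m i n v)))
            \<le> slope E (\<lambda>v. \<Sum>i=1..k. f i v) x"
proof -
  let ?S = "\<lambda>v. \<Sum>i=1..k. f i v"
  obtain s where s: "slope E ?S x = ereal s" "0 \<le> s"
    using fin slope_nonneg[of ?S x] by (cases "slope E ?S x") auto
  have f_MInf: "f i v \<noteq> -\<infinity>" if "i \<in> {1..k}" for i v using f[OF that] unfolding LSC_iff by blast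
  then have S_MInf: "?S v \<noteq> -\<infinity>" for v by (intro sum_not_MInf) auto
  have "?S x < \<infinity>" using fin x by (auto simp: slope_def split: if_splits)
  then have f_PInf: "f i x \<noteq> \<infinity>" if "i \<in> {1..k}" for i using that by (auto simp: sum_Pinfty)
  define a where "a i = real_of_ereal (f i x)" for i
  have a: "f i x = ereal (a i)" if "i \<in> {1..k}" for i
    using f_MInf[OF that, of x] f_PInf[OF that] by (cases "f i x") (simp_all add: a_def)
  define \<eta> where "\<eta> n = inverse (real (Suc n))" for n
  have \<eta>: "\<eta> n > 0" for n by (simp add: \<eta>_def)
  have \<eta>0: "\<eta> \<longlonglongrightarrow> 0" unfolding \<eta>_def by (rule LIMSEQ_inverse_real_of_nat)
  have "\<exists>y m. (\<forall>i\<in>{1..k}. (y i, m i) \<in> subdiff_graph D E (f i) \<and> m i \<in> dual E \<and> ndist E (y i) x \<le> \<eta> n \<and>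
      ereal (a i - \<eta> n) \<le> f i (y i) \<and> f i (y i) \<le> ereal (a i + real k * \<eta> n) \<and>
      ndiam E k y * dual_norm E (m i) \<le> \<eta> n * (2 * (s + \<eta> n) + 4 * \<eta> n + 2 * real k + 2)) \<and>
      dual_norm E (\<lambda>v. \<Sum>i=1..k. m i v) \<le> (s + \<eta> n) + 2 * \<eta> n" for n
  proof -
    have "slope E ?S x < ereal (s + \<eta> n)" using s \<eta>[of n] by simp
    then obtain r where r: "r > 0"
      "\<And>y. y \<in> carrier E \<Longrightarrow> ndist E x y < r \<Longrightarrow> ?S x \<le> ?S y + ereal ((s + \<eta> n) * ndist E x y)"
      using slope_lower_bound[of ?S x "s + \<eta> n"] S_MInf by blast
    have "0 \<le> s + \<eta> n" using s(2) \<eta>[of n] by simp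
    from approximate_sum_rule[OF D k R1 f x a this r dec \<eta>] show ?thesis .
  qed
  then obtain y m where ym: "\<And>n i. i \<in> {1..k} \<Longrightarrow> (y n i, m n i) \<in> subdiff_graph D E (f i) \<and>
      m n i \<in> dual E \<and> ndist E (y n i) x \<le> \<eta> n \<and>
      ereal (a i - \<eta> n) \<le> f i (y n i) \<and> f i (y n i) \<le> ereal (a i + real k * \<eta> n) \<and>
      ndiam E k (y n) * dual_norm E (m n i) \<le> \<eta> n * (2 * (s + \<eta> n) + 4 * \<eta> n + 2 * real k + 2)"
    and sum_m: "\<And>n. dual_norm E (\<lambda>v. \<Sum>i=1..k. m n i v) \<le> (s + \<eta> n) + 2 * \<eta> n"
    by metis
  have "(\<forall>n. (y n i, m n i) \<in> subdiff_graph D E (f i)) \<and>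
      limitin (ntop E) (\<lambda>n. y n i) x sequentially \<and> (\<lambda>n. f i (y n i)) \<longlonglongrightarrow> f i x \<and>
      (\<lambda>n. ndiam E k (\<lambda>j. y n j) * dual_norm E (m n i)) \<longlonglongrightarrow> 0" if i: "i \<in> {1..k}" for i
  proof (intro conjI allI)
    show "(y n i, m n i) \<in> subdiff_graph D E (f i)" for n using ym[OF i] by blast
    then have "y n i \<in> carrier E" for n by (simp add: subdiff_graph_def)
    then show "limitin (ntop E) (\<lambda>n. y n i) x sequentially"
      using ym[OF i] by (intro limitin_if_ndist_le[OF _ x _ \<eta>0]) auto
    have "(\<lambda>n. a i - \<eta> n) \<longlonglongrightarrow> a i - 0" "(\<lambda>n. a i + real k * \<eta> n) \<longlonglongrightarrow> a i + real k * 0"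
      by (intro tendsto_intros \<eta>0)+
    then have "(\<lambda>n. ereal (a i - \<eta> n)) \<longlonglongrightarrow> ereal (a i)" "(\<lambda>n. ereal (a i + real k * \<eta> n)) \<longlonglongrightarrow> ereal (a i)"
      by simp_all
    then show "(\<lambda>n. f i (y n i)) \<longlonglongrightarrow> f i x" unfolding a[OF i]
      by (rule tendsto_sandwich[rotated 2]) (use ym[OF i] in auto)
    have lim0: "(\<lambda>n. \<eta> n * (2 * (s + \<eta> n) + 4 * \<eta> n + 2 * real k + 2)) \<longlonglongrightarrow> 0 * (2 * (s + 0) + 4 * 0 + 2 * real k + 2)"
      by (intro tendsto_intros \<eta>0)
    show "(\<lambda>n. ndiam E k (\<lambda>j. y n j) * dual_norm E (m n i)) \<longlonglongrightarrow> 0"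
    proof (rule tendsto_sandwich[OF always_eventually always_eventually tendsto_const])
      show "\<forall>n. 0 \<le> ndiam E k (\<lambda>j. y n j) * dual_norm E (m n i)"
      proof
        fix n
        have "0 \<le> ndiam E k (y n)"
          by (rule order_trans[OF metric.nonneg ndist_le_ndiam[of i k i]]) (use i in auto)
        then show "0 \<le> ndiam E k (\<lambda>j. y n j) * dual_norm E (m n i)"
          using ym[OF i] dual_norm_nonneg by (intro mult_nonneg_nonneg) auto
      qed
      show "\<forall>n. ndiam E k (\<lambda>j. y n j) * dual_norm E (m n i) \<le> \<eta> n * (2 * (s + \<eta> n) + 4 * \<eta> n + 2 * real k + 2)"
        using ym[OF i] by auto
      show "(\<lambda>n. \<eta> n * (2 * (s + \<eta> n) + 4 * \<eta> n + 2 * real k + 2)) \<longlonglongrightarrow> 0" using lim0 by simp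
    qed
  qed
  moreover have "limsup (\<lambda>n. ereal (dual_norm E (\<lambda>v. \<Sum>i=1..k. m n i v))) \<le> slope E ?S x"
  proof -
    have "(\<lambda>n. (s + \<eta> n) + 2 * \<eta> n) \<longlonglongrightarrow> (s + 0) + 2 * 0" by (intro tendsto_intros \<eta>0)
    then have "(\<lambda>n. ereal ((s + \<eta> n) + 2 * \<eta> n)) \<longlonglongrightarrow> ereal s" by simp
    then have "limsup (\<lambda>n. ereal ((s + \<eta> n) + 2 * \<eta> n)) = ereal s"
      by (intro lim_imp_Limsup) auto
    moreover have "limsup (\<lambda>n. ereal (dual_norm E (\<lambda>v. \<Sum>i=1..k. m n i v))) \<le> limsup (\<lambda>n. ereal ((s + \<eta> n) + 2 * \<eta> n))"
      by (intro Limsup_mono always_eventually) (use sum_m in simp)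
    ultimately show ?thesis unfolding s(1) by metis
  qed
  ultimately show ?thesis by (intro exI[of _ "\<lambda>i n. y n i"] exI[of _ "\<lambda>i n. m n i"]) simp
qed

text \<open>
  A functional \<open>m\<close> with \<open>m \<le> l\<close> equals \<open>l\<close>, as follows on replacing \<open>h\<close> by \<open>- h\<close>.
\<close>

lemma subdiff_functional:
  assumes D: "subdifferential D" and l: "l \<in> dual E" and x: "x \<in> carrier E"
  shows "D E (ext E l) x = {l}"
proof -
  have conv: "nconvex_on E (carrier E) (ext E l)"
    by (auto simp: nconvex_on_def ext_def dual_add[OF l] dual_scalar[OF l])
  have "D E (ext E l) x = {m \<in> dual E. \<forall>v\<in>carrier E. m (v \<ominus> x) + l x \<le> l v}"
    by (rule subdifferential_lipschitz_convex[OF D banach_space_axioms dual_lipschitz[OF l] conv x])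
  also have "\<dots> = {l}"
  proof (intro equalityI subsetI)
    fix m assume "m \<in> {m \<in> dual E. \<forall>v\<in>carrier E. m (v \<ominus> x) + l x \<le> l v}"
    then have m: "m \<in> dual E" and sub: "\<And>v. v \<in> carrier E \<Longrightarrow> m (v \<ominus> x) + l x \<le> l v"
      by auto
    have le: "m h \<le> l h" if "h \<in> carrier E" for h
      using that x sub[of "x \<oplus> h"] by (simp add: add_diff_cancel dual_add[OF l])
    have "m v = l v" for v
    proof (cases "v \<in> carrier E")
      case True
      then show ?thesis using le[of v] le[of "(-1) \<odot>\<^bsub>E\<^esub> v"] by (simp add: dual_scalar[OF m] dual_scalar[OF l])
    qed (simp add: dual_off[OF m] dual_off[OF l])
    then show "m \<in> {l}" by auto
  qed (use l x in \<open>auto simp: dual_diff\<close>)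
  finally show ?thesis .
qed

text \<open>
  Adding the functional \<open>- l\<close> to the family turns the Frechet subgradient \<open>l\<close> into a vanishing slope.
  The diameter of the first \<open>k\<close> points is at most that of all \<open>k + 1\<close>.
\<close>

theorem frechet_sum_rule:
  assumes D: "subdifferential D" and k: "1 \<le> k" and R1: "fuzzy_min_rule D (pow_space E (Suc k))"
    and f: "\<And>i. i \<in> {1..k} \<Longrightarrow> f i \<in> LSC E" and x: "x \<in> carrier E"
    and dec: "dual_decouplable E k f x" and l: "l \<in> frechet_subdiff E (\<lambda>v. \<Sum>i=1..k. f i v) x"
  shows "\<exists>(y :: nat \<Rightarrow> nat \<Rightarrow> 'a uni) (m :: nat \<Rightarrow> nat \<Rightarrow> 'a uni \<Rightarrow> real).
          (\<forall>i\<in>{1..k}.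
             (\<forall>n. (y i n, m i n) \<in> subdiff_graph D E (f i)) \<and>
             limitin (ntop E) (y i) x sequentially \<and>
             (\<lambda>n. f i (y i n)) \<longlonglongrightarrow> f i x \<and>
             (\<lambda>n. ndiam E k (\<lambda>j. y j n) * dual_norm E (m i n)) \<longlonglongrightarrow> 0) \<and>
          (\<lambda>n. dual_norm E (\<lambda>v. (\<Sum>i=1..k. m i n v) - l v)) \<longlonglongrightarrow> 0"
proof -
  have ld: "l \<in> dual E" using l by (simp add: frechet_subdiff_def)
  let ?l = "\<lambda>v. - l v"
  let ?f = "f(Suc k := ext E ?l)"
  have l': "?l \<in> dual E" by (rule dual_minus[OF ld])
  have f': "?f i \<in> LSC E" if "i \<in> {1..Suc k}" for i
    using that f ext_LSC[OF dual_lipschitz[OF l']] by auto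
  have "f i v \<noteq> -\<infinity>" if "i \<in> {1..k}" for i v using f[OF that] unfolding LSC_iff by blast
  then have S_MInf: "(\<Sum>i=1..k. f i v) \<noteq> -\<infinity>" for v by (intro sum_not_MInf) auto
  have sum': "(\<Sum>i=1..Suc k. ?f i v) = (\<Sum>i=1..k. f i v) + ext E ?l v" for v by simp
  have slope0: "slope E (\<lambda>v. \<Sum>i=1..Suc k. ?f i v) x = 0"
    unfolding sum' by (rule slope_frechet[OF l S_MInf])
  have dec': "decouplable E (Suc k) ?f x" using dec l' unfolding dual_decouplable_def by blast
  have k': "1 \<le> Suc k" by simp
  have fin: "slope E (\<lambda>v. \<Sum>i=1..Suc k. ?f i v) x < \<infinity>" unfolding slope0 by simp
  from slope_sum_rule[OF D k' R1 f' x dec' fin, unfolded slope0]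
  obtain y :: "nat \<Rightarrow> nat \<Rightarrow> 'a uni" and m :: "nat \<Rightarrow> nat \<Rightarrow> 'a uni \<Rightarrow> real" where
    ym: "\<And>i. i \<in> {1..Suc k} \<Longrightarrow>
             (\<forall>n. (y i n, m i n) \<in> subdiff_graph D E (?f i)) \<and>
             limitin (ntop E) (y i) x sequentially \<and>
             (\<lambda>n. ?f i (y i n)) \<longlonglongrightarrow> ?f i x \<and>
             (\<lambda>n. ndiam E (Suc k) (\<lambda>j. y j n) * dual_norm E (m i n)) \<longlonglongrightarrow> 0"
    and ls: "limsup (\<lambda>n. ereal (dual_norm E (\<lambda>v. \<Sum>i=1..Suc k. m i n v))) \<le> 0"
    by blast
  have m_dual: "m i n \<in> dual E" if i: "i \<in> {1..Suc k}" for i n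
  proof -
    have "y i n \<in> carrier E" "m i n \<in> D E (?f i) (y i n)" using ym[OF i] by (auto simp: subdiff_graph_def)
    then show ?thesis using subdifferential_subset_dual[OF D banach_space_axioms f'[OF i]] by blast
  qed
  have last: "m (Suc k) n = ?l" for n
  proof -
    have "(y (Suc k) n, m (Suc k) n) \<in> subdiff_graph D E (ext E ?l)" using ym[of "Suc k"] by simp
    then show ?thesis using subdiff_functional[OF D l'] by (auto simp: subdiff_graph_def)
  qed
  have sum_eq: "(\<lambda>v. \<Sum>i=1..Suc k. m i n v) = (\<lambda>v. (\<Sum>i=1..k. m i n v) - l v)" for n
    by (simp add: last)
  have nonneg: "0 \<le> dual_norm E (\<lambda>v. (\<Sum>i=1..k. m i n v) - l v)" for n
    unfolding sum_eq[symmetric] by (intro dual_norm_nonneg dual_sum m_dual) auto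
  have "(\<lambda>n. dual_norm E (\<lambda>v. (\<Sum>i=1..k. m i n v) - l v)) \<longlonglongrightarrow> 0"
  proof (rule limsup_le_liminf_real)
    show "limsup (\<lambda>n. ereal (dual_norm E (\<lambda>v. (\<Sum>i=1..k. m i n v) - l v))) \<le> ereal 0"
      using ls unfolding sum_eq by (simp add: zero_ereal_def)
    show "ereal 0 \<le> liminf (\<lambda>n. ereal (dual_norm E (\<lambda>v. (\<Sum>i=1..k. m i n v) - l v)))"
      by (intro Liminf_bounded always_eventually) (use nonneg in simp)
  qed
  moreover have "(\<forall>n. (y i n, m i n) \<in> subdiff_graph D E (f i)) \<and>
      limitin (ntop E) (y i) x sequentially \<and> (\<lambda>n. f i (y i n)) \<longlonglongrightarrow> f i x \<and>
      (\<lambda>n. ndiam E k (\<lambda>j. y j n) * dual_norm E (m i n)) \<longlonglongrightarrow> 0" if i: "i \<in> {1..k}" for i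
  proof -
    have i': "i \<in> {1..Suc k}" and ne: "?f i = f i" using i by auto
    have diam: "0 \<le> ndiam E k z" "ndiam E k z \<le> ndiam E (Suc k) z" for z
      using order_trans[OF metric.nonneg ndist_le_ndiam[OF i i]] ndiam_le_iff[OF k, of E z]
        ndist_le_ndiam[of _ "Suc k" _ E z] by auto
    have lim: "(\<lambda>n. ndiam E (Suc k) (\<lambda>j. y j n) * dual_norm E (m i n)) \<longlonglongrightarrow> 0" using ym[OF i'] by blast
    have "(\<lambda>n. ndiam E k (\<lambda>j. y j n) * dual_norm E (m i n)) \<longlonglongrightarrow> 0"
      by (rule tendsto_sandwich[OF always_eventually always_eventually tendsto_const lim])
        (use diam dual_norm_nonneg[OF m_dual[OF i']] in \<open>auto intro: mult_right_mono\<close>)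
    then show ?thesis using ym[OF i'] unfolding ne by blast
  qed
  ultimately show ?thesis by (intro exI[of _ y] exI[of _ m]) simp
qed

end

theorem theorem7p2:
  fixes D :: "'a uni subdiff_op"
    and \<X> :: "'a uni nvs set"
  assumes "subdifferential D"
    and "\<And>E. E \<in> \<X> \<Longrightarrow> banach_space E"
    and "\<And>E G. E \<in> \<X> \<Longrightarrow> G \<in> \<X> \<Longrightarrow> prod_space E G \<in> \<X>"
    and "\<And>E. E \<in> \<X> \<Longrightarrow> fuzzy_min_rule D E"
  shows "\<forall>E\<in>\<X>.
    (\<forall>k f xbar. 1 \<le> k \<and> (\<forall>i\<in>{1..k}. f i \<in> LSC E) \<and> xbar \<in> carrier E \<and>
       decouplable E k f xbar \<and> slope E (\<lambda>v. \<Sum>i=1..k. f i v) xbar < \<infinity> \<longrightarrow>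
       (\<exists>(x :: nat \<Rightarrow> nat \<Rightarrow> 'a uni) (xs :: nat \<Rightarrow> nat \<Rightarrow> 'a uni \<Rightarrow> real).
          (\<forall>i\<in>{1..k}.
             (\<forall>n. (x i n, xs i n) \<in> subdiff_graph D E (f i)) \<and>
             limitin (ntop E) (x i) xbar sequentially \<and>
             (\<lambda>n. f i (x i n)) \<longlonglongrightarrow> f i xbar \<and>
             (\<lambda>n. ndiam E k (\<lambda>j. x j n) * dual_norm E (xs i n)) \<longlonglongrightarrow> 0) \<and>
          limsup (\<lambda>n. ereal (dual_norm E (\<lambda>v. \<Sum>i=1..k. xs i n v)))
            \<le> slope E (\<lambda>v. \<Sum>i=1..k. f i v) xbar)) \<and>
    (\<forall>k f xbar xbars. 1 \<le> k \<and> (\<forall>i\<in>{1..k}. f i \<in> LSC E) \<and> xbar \<in> carrier E \<and>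
       dual_decouplable E k f xbar \<and> xbars \<in> frechet_subdiff E (\<lambda>v. \<Sum>i=1..k. f i v) xbar \<longrightarrow>
       (\<exists>(x :: nat \<Rightarrow> nat \<Rightarrow> 'a uni) (xs :: nat \<Rightarrow> nat \<Rightarrow> 'a uni \<Rightarrow> real).
          (\<forall>i\<in>{1..k}.
             (\<forall>n. (x i n, xs i n) \<in> subdiff_graph D E (f i)) \<and>
             limitin (ntop E) (x i) xbar sequentially \<and>
             (\<lambda>n. f i (x i n)) \<longlonglongrightarrow> f i xbar \<and>
             (\<lambda>n. ndiam E k (\<lambda>j. x j n) * dual_norm E (xs i n)) \<longlonglongrightarrow> 0) \<and>
          (\<lambda>n. dual_norm E (\<lambda>v. (\<Sum>i=1..k. xs i n v) - xbars v)) \<longlonglongrightarrow> 0))"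
proof (intro ballI conjI allI impI)
  fix E assume E: "E \<in> \<X>"
  have pow: "pow_space E k \<in> \<X>" for k
    by (induction k) (use E assms(3) in auto)
  interpret banach_powers E
    by (rule banach_powers.intro) (rule assms(2)[OF pow])
  fix k f xbar
  {
    assume "1 \<le> k \<and> (\<forall>i\<in>{1..k}. f i \<in> LSC E) \<and> xbar \<in> carrier E \<and>
       decouplable E k f xbar \<and> slope E (\<lambda>v. \<Sum>i=1..k. f i v) xbar < \<infinity>"
    then show "\<exists>(x :: nat \<Rightarrow> nat \<Rightarrow> 'a uni) (xs :: nat \<Rightarrow> nat \<Rightarrow> 'a uni \<Rightarrow> real).
          (\<forall>i\<in>{1..k}.
             (\<forall>n. (x i n, xs i n) \<in> subdiff_graph D E (f i)) \<and>
             limitin (ntop E) (x i) xbar sequentially \<and>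
             (\<lambda>n. f i (x i n)) \<longlonglongrightarrow> f i xbar \<and>
             (\<lambda>n. ndiam E k (\<lambda>j. x j n) * dual_norm E (xs i n)) \<longlonglongrightarrow> 0) \<and>
          limsup (\<lambda>n. ereal (dual_norm E (\<lambda>v. \<Sum>i=1..k. xs i n v)))
            \<le> slope E (\<lambda>v. \<Sum>i=1..k. f i v) xbar"
      using slope_sum_rule[OF assms(1) _ assms(4)[OF pow], of k f xbar] by simp
  next
    fix xbars
    assume "1 \<le> k \<and> (\<forall>i\<in>{1..k}. f i \<in> LSC E) \<and> xbar \<in> carrier E \<and>
       dual_decouplable E k f xbar \<and> xbars \<in> frechet_subdiff E (\<lambda>v. \<Sum>i=1..k. f i v) xbar"
    then show "\<exists>(x :: nat \<Rightarrow> nat \<Rightarrow> 'a uni) (xs :: nat \<Rightarrow> nat \<Rightarrow> 'a uni \<Rightarrow> real).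
          (\<forall>i\<in>{1..k}.
             (\<forall>n. (x i n, xs i n) \<in> subdiff_graph D E (f i)) \<and>
             limitin (ntop E) (x i) xbar sequentially \<and>
             (\<lambda>n. f i (x i n)) \<longlonglongrightarrow> f i xbar \<and>
             (\<lambda>n. ndiam E k (\<lambda>j. x j n) * dual_norm E (xs i n)) \<longlonglongrightarrow> 0) \<and>
          (\<lambda>n. dual_norm E (\<lambda>v. (\<Sum>i=1..k. xs i n v) - xbars v)) \<longlonglongrightarrow> 0"
      using frechet_sum_rule[OF assms(1) _ assms(4)[OF pow], of k f xbar xbars] by simp
  }
qed

end
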